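(* Let $\rho$ be a positive integer, let $b\in\mathbb{Z}_n\setminus\{0\}$ and let $C_n$ be the cycle on $n$ vertices. The graph $C_n+\rho\,\{0,b\}$ does not admit perfect vertex state transfer with respect to the Laplacian matrix for $n\ge 15$, and with respect to the signless Laplacian matrix for $n\ge 9$.
   Context: $C_n$ is the cycle with vertex set $\mathbb{Z}_n$, vertices $i,j$ adjacent (weight 1) iff $i-j\equiv\pm1\pmod n$. $C_n+\rho\{0,b\}$ is the weighted graph obtained by adding an edge of weight $\rho$ between vertices $0$ and $b$ (if $0,b$ are already adjacent, the weight of that edge becomes $1+\rho$). With $A$ the weighted adjacency matrix and $\Delta$ the diagonal matrix of its row sums, the Laplacian is $L=\Delta-A$ and the signless Laplacian is $Q=\Delta+A$. Perfect vertex state transfer with respect to a real symmetric matrix $B$ means that there are distinct vertices $u,v$, some $\tau>0$ and $\gamma\in\mathbb{C}$ with $\exp(i\tau B)\mathbf{e}_u=\gamma\mathbf{e}_v$, where $\mathbf{e}_u$ is the characteristic vector of $u$. *)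

theory Defs
  imports Complex_Main "HOL-Number_Theory.Cong" "Jordan_Normal_Form.Matrix"
begin

text \<open>A weighted graph on the vertices \<open>0, \<dots>, n - 1\<close> is given by its number \<open>n\<close> of vertices
  and its symmetric weight function, where weight \<open>0\<close> means that there is no edge.  The residue
  classes modulo \<open>n\<close> are represented by \<open>0, \<dots>, n - 1\<close>.\<close>

definition cycle_weight :: "nat \<Rightarrow> nat \<Rightarrow> nat \<Rightarrow> real" where
  "cycle_weight n i j =
     (if [int i - int j = 1] (mod int n) \<or> [int i - int j = - 1] (mod int n) then 1 else 0)"

definition add_edge :: "(nat \<Rightarrow> nat \<Rightarrow> real) \<Rightarrow> real \<Rightarrow> nat \<Rightarrow> nat \<Rightarrow> nat \<Rightarrow> nat \<Rightarrow> real" where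
  "add_edge w r a b i j = w i j + (if {i, j} = {a, b} then r else 0)"

definition adjacency_mat :: "nat \<Rightarrow> (nat \<Rightarrow> nat \<Rightarrow> real) \<Rightarrow> real mat" where
  "adjacency_mat n w = mat n n (\<lambda>(i, j). w i j)"

definition row_sum_mat :: "real mat \<Rightarrow> real mat" where
  "row_sum_mat A = mat (dim_row A) (dim_row A)
     (\<lambda>(i, j). if i = j then (\<Sum>k<dim_col A. A $$ (i, k)) else 0)"

definition laplacian_mat :: "nat \<Rightarrow> (nat \<Rightarrow> nat \<Rightarrow> real) \<Rightarrow> real mat" where
  "laplacian_mat n w = row_sum_mat (adjacency_mat n w) - adjacency_mat n w"

definition signless_laplacian_mat :: "nat \<Rightarrow> (nat \<Rightarrow> nat \<Rightarrow> real) \<Rightarrow> real mat" where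
  "signless_laplacian_mat n w = row_sum_mat (adjacency_mat n w) + adjacency_mat n w"

text \<open>The exponential of a square matrix, defined by its power series; convergence in the
  matrix space is entrywise convergence, and every entry converges absolutely.\<close>

definition mat_exp :: "complex mat \<Rightarrow> complex mat" where
  "mat_exp M = mat (dim_row M) (dim_row M) (\<lambda>(i, j). \<Sum>k. (M ^\<^sub>m k) $$ (i, j) / fact k)"

text \<open>Only meaningful for square matrices; intended for real symmetric ones.\<close>

definition perfect_vertex_state_transfer :: "real mat \<Rightarrow> bool" where
  "perfect_vertex_state_transfer B \<longleftrightarrow>
     (\<exists>u < dim_row B. \<exists>v < dim_row B. u \<noteq> v \<and>
       (\<exists>\<tau>::real. \<exists>\<gamma>::complex. \<tau> > 0 \<and>
          mat_exp ((\<i> * complex_of_real \<tau>) \<cdot>\<^sub>m map_mat complex_of_real B) *\<^sub>v unit_vec (dim_row B) u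
            = \<gamma> \<cdot>\<^sub>v unit_vec (dim_row B) v))"

end

theory Submission
  imports Defs "HOL-Computational_Algebra.Polynomial"
begin

text \<open>
  Let \<open>z\<close> be a real eigenvector of a real symmetric matrix \<open>B\<close> with eigenvalue \<open>\<theta>\<close>.  If the transition
  matrix \<open>exp (\<i> \<tau> B)\<close> sends vertex \<open>u\<close> to \<open>\<gamma>\<close> times vertex \<open>v\<close>, then pairing with \<open>z\<close> gives
  \<open>cis (\<tau> \<theta>) z\<^sub>u = \<gamma> z\<^sub>v\<close>.  Comparing two eigenvectors that do not vanish at \<open>u\<close> shows that
  \<open>\<tau> (\<theta> - \<theta>')\<close> is a multiple of \<open>\<pi>\<close>.  Hence all differences of eigenvalues in the support of \<open>u\<close>
  have rational ratios (\<open>support_ratio\<close>), and \<open>\<bar>z\<^sub>u\<bar> / \<bar>z\<^sub>v\<bar>\<close> is the same for all eigenvectors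
  (\<open>modulus\<close>).  The proof exhibits enough explicit eigenvectors to contradict these two facts.

  The cosine and sine waves on the cycle that are symmetric, respectively antisymmetric, under the
  reflection \<open>i \<mapsto> b - i\<close> do not feel the additional edge: they remain eigenvectors of the
  Laplacian, respectively the signless Laplacian, with the eigenvalues \<open>2 \<mp> 2 cos (2 \<pi> k / n)\<close> of
  the cycle.  Their value at \<open>u\<close> is the cosine or sine of \<open>k \<phi>\<close> with \<open>\<phi> = \<pi> (2 u - b) / n\<close>, so for most
  small \<open>k\<close> they do not vanish there.

  For the Laplacian, \<open>0\<close> is also in the support, and the ratios of eigenvalues force
  \<open>cos (2 \<pi> / n)\<close> or \<open>cos (4 \<pi> / n)\<close> to be rational.  A rational value of \<open>2 cos\<close> at a rational multiple
  of \<open>\<pi>\<close> is an integer (Niven), which is impossible for \<open>n \<ge> 13\<close> because the value lies strictly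
  between \<open>1\<close> and \<open>2\<close>.

  For the signless Laplacian and \<open>sin \<phi> \<noteq> 0\<close> the same idea works with four values \<open>k \<le> 5\<close>, unless
  \<open>cos \<phi> = 0\<close>.  Then only odd \<open>k\<close> are available, and the ratios of their differences leave
  \<open>n = 12\<close>, where all of them lie in \<open>\<rat> \<surd>3\<close>.  In that case the positive (Perron) eigenvector decides:
  its eigenvalue would have to be \<open>2 + q \<surd>3\<close> with \<open>q\<close> rational, and the secular equation for it
  equates an element of \<open>\<rat> \<surd>3\<close> with a positive rational number.

  If \<open>sin \<phi> = 0\<close>, then \<open>u\<close> is fixed by the reflection and the antisymmetric waves say nothing about
  it; but they show that \<open>v\<close> is fixed as well, so \<open>u\<close> and \<open>v\<close> are the midpoints of the two arcs from
  \<open>0\<close> to \<open>b\<close>.  Symmetric eigenvectors are glued from one hyperbolic or one trigonometric cosine on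
  each arc (\<open>signless_two_arcs\<close>).  If the arcs have different lengths, the Perron vector is larger
  at the midpoint of one of them and some oscillating eigenvector is larger at the other, which
  contradicts \<open>modulus\<close>.  If the arcs have equal length, there is a second reflection, which fixes \<open>0\<close>
  and \<open>b\<close>; its antisymmetric waves with odd \<open>k\<close> do not vanish at \<open>u\<close>, and the previous paragraph
  applies again.
\<close>

section \<open>Matrix exponentials and eigenvectors\<close>

text \<open>Row rather than column eigenvectors, because they are paired with the columns of the
  exponential.  Indexing by functions on \<open>nat\<close> lets a closed formula serve as eigenvector without
  reference to the dimension.\<close>

definition row_eigenvector :: "real mat \<Rightarrow> (nat \<Rightarrow> real) \<Rightarrow> real \<Rightarrow> bool" where
  "row_eigenvector B z \<theta> \<longleftrightarrow>
     (\<forall>j<dim_row B. (\<Sum>i<dim_row B. z i * B $$ (i, j)) = \<theta> * z j)"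

text \<open>The sum of the moduli of all entries is a submultiplicative norm; it makes the exponential series
  converge entrywise.\<close>

lemma pow_mat_entry_bound:
  fixes M :: "complex mat"
  assumes M: "M \<in> carrier_mat n n"
  obtains K where "\<And>k i j. i < n \<Longrightarrow> j < n \<Longrightarrow> norm ((M ^\<^sub>m k) $$ (i, j)) \<le> K ^ k"
proof -
  define S where "S = (\<Sum>l<n. \<Sum>j<n. norm (M $$ (l, j)))"
  have entry: "norm (M $$ (l, j)) \<le> (\<Sum>j<n. norm (M $$ (l, j)))" if "j < n" for l j
    using that by (intro member_le_sum) auto
  have "norm ((M ^\<^sub>m k) $$ (i, j)) \<le> S ^ k" if "i < n" "j < n" for k i j
    using that
  proof (induction k arbitrary: j)
    case 0
    then show ?case using M by simp
  next
    case (Suc k)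
    have "(M ^\<^sub>m Suc k) $$ (i, j) = (\<Sum>l<n. (M ^\<^sub>m k) $$ (i, l) * M $$ (l, j))"
      using M Suc.prems by (simp add: scalar_prod_def lessThan_atLeast0)
    also have "norm \<dots> \<le> (\<Sum>l<n. S ^ k * norm (M $$ (l, j)))"
      using Suc by (intro sum_norm_le) (auto simp: norm_mult intro!: mult_right_mono)
    also have "\<dots> \<le> (\<Sum>l<n. S ^ k * (\<Sum>j<n. norm (M $$ (l, j))))"
      using entry Suc.prems by (intro sum_mono mult_left_mono) (auto simp: S_def intro!: sum_nonneg zero_le_power)
    also have "\<dots> = S ^ Suc k"
      by (simp add: S_def sum_distrib_left sum_distrib_right mult.commute)
    finally show ?case .
  qed
  then show thesis by (rule that)
qed

lemma summable_mat_exp_entry: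
  fixes M :: "complex mat"
  assumes "M \<in> carrier_mat n n" "i < n" "j < n"
  shows "summable (\<lambda>k. (M ^\<^sub>m k) $$ (i, j) / fact k)"
proof -
  obtain K where K: "\<And>k i j. i < n \<Longrightarrow> j < n \<Longrightarrow> norm ((M ^\<^sub>m k) $$ (i, j)) \<le> K ^ k"
    using pow_mat_entry_bound[OF assms(1)] by blast
  show ?thesis
  proof (rule summable_comparison_test')
    show "summable (\<lambda>k. inverse (fact k) * K ^ k)" by (rule summable_exp)
    show "norm ((M ^\<^sub>m k) $$ (i, j) / fact k) \<le> inverse (fact k) * K ^ k" if "k \<ge> 0" for k
      using K[OF assms(2,3), of k] by (simp add: norm_divide divide_simps)
  qed
qed

lemma row_eigenvector_pow_mat:
  fixes M :: "complex mat"
  assumes M: "M \<in> carrier_mat n n"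
    and z: "\<And>j. j < n \<Longrightarrow> (\<Sum>i<n. z i * M $$ (i, j)) = \<mu> * z j"
    and j: "j < n"
  shows "(\<Sum>i<n. z i * (M ^\<^sub>m k) $$ (i, j)) = \<mu> ^ k * z j"
  using j
proof (induction k arbitrary: j)
  case 0
  have "(\<Sum>i<n. z i * (1\<^sub>m n) $$ (i, j)) = (\<Sum>i<n. if i = j then z i else 0)"
    using 0 by (intro sum.cong) auto
  then show ?case using M 0 by simp
next
  case (Suc k)
  have "(\<Sum>i<n. z i * (M ^\<^sub>m Suc k) $$ (i, j))
      = (\<Sum>i<n. \<Sum>l<n. z i * (M ^\<^sub>m k) $$ (i, l) * M $$ (l, j))"
    using M Suc.prems
    by (intro sum.cong) (auto simp: scalar_prod_def lessThan_atLeast0 sum_distrib_left mult_ac)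
  also have "\<dots> = (\<Sum>l<n. (\<Sum>i<n. z i * (M ^\<^sub>m k) $$ (i, l)) * M $$ (l, j))"
    by (subst sum.swap) (simp add: sum_distrib_right)
  also have "\<dots> = (\<Sum>l<n. \<mu> ^ k * z l * M $$ (l, j))"
    using Suc.IH by (intro sum.cong) auto
  also have "\<dots> = \<mu> ^ k * (\<Sum>l<n. z l * M $$ (l, j))"
    by (simp add: sum_distrib_left mult_ac)
  finally show ?case using z[OF Suc.prems] by simp
qed

text \<open>Convergence of each entry allows the finite sum over \<open>i\<close> to be interchanged with the series.\<close>

lemma row_eigenvector_mat_exp:
  fixes M :: "complex mat"
  assumes M: "M \<in> carrier_mat n n"
    and z: "\<And>j. j < n \<Longrightarrow> (\<Sum>i<n. z i * M $$ (i, j)) = \<mu> * z j"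
    and j: "j < n"
  shows "(\<Sum>i<n. z i * mat_exp M $$ (i, j)) = exp \<mu> * z j"
proof -
  have "(\<Sum>i<n. z i * mat_exp M $$ (i, j))
      = (\<Sum>i<n. \<Sum>k. z i * ((M ^\<^sub>m k) $$ (i, j) / fact k))"
    using M j summable_mat_exp_entry[OF M _ j]
    by (intro sum.cong) (auto simp: mat_exp_def suminf_mult[symmetric])
  also have "\<dots> = (\<Sum>k. \<Sum>i<n. z i * ((M ^\<^sub>m k) $$ (i, j) / fact k))"
    using summable_mat_exp_entry[OF M _ j]
    by (intro suminf_sum[symmetric] summable_mult) auto
  also have "\<dots> = (\<Sum>k. \<mu> ^ k /\<^sub>R fact k * z j)"
    using row_eigenvector_pow_mat[OF M z j]
    by (intro suminf_cong)
      (simp add: sum_divide_distrib[symmetric] scaleR_conv_of_real field_simps)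
  also have "\<dots> = exp \<mu> * z j"
    unfolding exp_def by (rule suminf_mult2[symmetric]) (rule summable_exp_generic)
  finally show ?thesis .
qed

section \<open>Spectral consequences of state transfer\<close>

lemma cis_real_multiple:
  assumes "cis x * of_real p = of_real q" "p \<noteq> 0"
  shows "x / pi \<in> \<int>"
proof -
  have "sin x * p = 0" using assms(1) by (simp add: complex_eq_iff)
  then obtain k :: int where "x = of_int k * pi" using assms(2) by (auto simp: sin_zero_iff_int2)
  then show ?thesis by simp
qed

locale state_transfer =
  fixes B :: "real mat" and n u v :: nat and \<tau> :: real and \<gamma> :: complex
  assumes carrier: "B \<in> carrier_mat n n"
    and u: "u < n" and v: "v < n" and uv: "u \<noteq> v" and \<tau>: "\<tau> > 0"
    and transfer: "mat_exp ((\<i> * complex_of_real \<tau>) \<cdot>\<^sub>m map_mat complex_of_real B) *\<^sub>v unit_vec n u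
                     = \<gamma> \<cdot>\<^sub>v unit_vec n v"
begin

lemma phase:
  assumes "row_eigenvector B z \<theta>"
  shows "cis (\<tau> * \<theta>) * of_real (z u) = \<gamma> * of_real (z v)"
proof -
  let ?M = "(\<i> * complex_of_real \<tau>) \<cdot>\<^sub>m map_mat complex_of_real B"
  have M: "?M \<in> carrier_mat n n" using carrier by simp
  have dimB: "dim_row B = n" "dim_col B = n" using carrier by auto
  have row: "(\<Sum>i<n. of_real (z i) * ?M $$ (i, j)) = (\<i> * of_real (\<tau> * \<theta>)) * of_real (z j)"
    if "j < n" for j
  proof -
    have "(\<Sum>i<n. of_real (z i) * ?M $$ (i, j))
        = \<i> * of_real \<tau> * of_real (\<Sum>i<n. z i * B $$ (i, j))"
      using that dimB by (simp add: sum_distrib_left mult_ac)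
    also have "(\<Sum>i<n. z i * B $$ (i, j)) = \<theta> * z j"
      using assms that dimB by (simp add: row_eigenvector_def)
    finally show ?thesis by (simp add: mult_ac)
  qed
  have column: "mat_exp ?M $$ (i, u) = \<gamma> * (if i = v then 1 else 0)" if "i < n" for i
  proof -
    have "mat_exp ?M $$ (i, u) = (mat_exp ?M *\<^sub>v unit_vec n u) $ i"
      using that u dimB by (simp add: mat_exp_def)
    also have "\<dots> = (\<gamma> \<cdot>\<^sub>v unit_vec n v) $ i"
      by (simp only: transfer)
    finally show ?thesis
      using that v by simp
  qed
  have "exp (\<i> * of_real (\<tau> * \<theta>)) * of_real (z u)
      = (\<Sum>i<n. of_real (z i) * mat_exp ?M $$ (i, u))"
    by (rule row_eigenvector_mat_exp[OF M row u, symmetric])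
  also have "\<dots> = (\<Sum>i<n. if i = v then \<gamma> * of_real (z i) else 0)"
    using column by (intro sum.cong) auto
  also have "\<dots> = \<gamma> * of_real (z v)" using v by simp
  finally show ?thesis by (simp add: cis_conv_exp)
qed

text \<open>The factor \<open>norm \<gamma>\<close> is common to all eigenvectors, so any two of them have the same ratio of moduli
  at \<open>u\<close> and \<open>v\<close>; in particular, a vector vanishing at \<open>v\<close> vanishes at \<open>u\<close>.\<close>

lemma modulus:
  assumes "row_eigenvector B z \<theta>"
  shows "\<bar>z u\<bar> = norm \<gamma> * \<bar>z v\<bar>"
  using arg_cong[OF phase[OF assms], of norm] by (simp add: norm_mult)

definition support :: "real set" where
  "support = {\<theta>. \<exists>z. row_eigenvector B z \<theta> \<and> z u \<noteq> 0}"

text \<open>The unknown phase \<open>\<gamma>\<close> cancels between two eigenvectors, which leaves a quotient of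
  real numbers on one side and a point of the unit circle on the other.\<close>

lemma support_diff:
  assumes "\<theta> \<in> support" "\<theta>' \<in> support"
  shows "\<tau> * (\<theta> - \<theta>') / pi \<in> \<int>"
proof -
  obtain z z' where z: "row_eigenvector B z \<theta>" "z u \<noteq> 0"
    and z': "row_eigenvector B z' \<theta>'" "z' u \<noteq> 0"
    using assms by (auto simp: support_def)
  have "z' v \<noteq> 0" using modulus[OF z'(1)] z'(2) by auto
  note p = phase[OF z(1)] and p' = phase[OF z'(1)]
  have "cis (\<tau> * (\<theta> - \<theta>')) * of_real (z u * z' v)
      = cis (- (\<tau> * \<theta>')) * (cis (\<tau> * \<theta>) * of_real (z u)) * of_real (z' v)"
    by (simp add: cis_mult mult.assoc[symmetric] right_diff_distrib)
  also have "\<dots> = cis (- (\<tau> * \<theta>')) * (\<gamma> * of_real (z' v)) * of_real (z v)"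
    by (simp only: p) (simp add: mult_ac)
  also have "\<dots> = of_real (z' u * z v)"
    by (simp add: p'[symmetric] mult.assoc[symmetric] cis_mult)
  finally show ?thesis
    using z(2) \<open>z' v \<noteq> 0\<close> cis_real_multiple[of "\<tau> * (\<theta> - \<theta>')" "z u * z' v" "z' u * z v"] by simp
qed

lemma support_ratio:
  assumes "\<theta>1 \<in> support" "\<theta>2 \<in> support" "\<theta>3 \<in> support" "\<theta>4 \<in> support"
  shows "(\<theta>1 - \<theta>2) / (\<theta>3 - \<theta>4) \<in> \<rat>"
proof -
  have "(\<tau> * (\<theta>1 - \<theta>2) / pi) / (\<tau> * (\<theta>3 - \<theta>4) / pi) \<in> \<rat>"
    using assms by (intro Rats_divide subsetD[OF Ints_subset_Rats] support_diff)
  then show ?thesis using \<tau> by simp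
qed

end

lemma perfect_vertex_state_transferE:
  assumes "perfect_vertex_state_transfer B" "B \<in> carrier_mat n n"
  obtains u v \<tau> \<gamma> where "state_transfer B n u v \<tau> \<gamma>"
  using assms unfolding perfect_vertex_state_transfer_def state_transfer_def by auto

section \<open>Rational cosines\<close>

text \<open>The Chebyshev polynomials rescaled to be monic with integer coefficients, so that
  \<open>2 cos x\<close> is a root of \<open>cheb n - 2\<close>, and thus an algebraic integer, whenever \<open>n x\<close> is a multiple
  of \<open>2 \<pi>\<close>.\<close>

fun cheb :: "nat \<Rightarrow> real poly" where
  "cheb 0 = [:2:]"
| "cheb (Suc 0) = [:0, 1:]"
| "cheb (Suc (Suc k)) = pCons 0 (cheb (Suc k)) - cheb k"

lemma poly_cheb: "poly (cheb k) (2 * cos x) = 2 * cos (of_nat k * x)"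
proof (induction k rule: cheb.induct)
  case (3 k)
  have "2 * cos x * cos (real (Suc k) * x) = cos (real k * x) + cos (real (Suc (Suc k)) * x)"
    using cos_times_cos[of "real (Suc k) * x" x] by (simp add: algebra_simps)
  then show ?case using 3 by (simp add: algebra_simps)
qed auto

lemma coeff_cheb_Ints: "coeff (cheb k) i \<in> \<int>"
  by (induction k arbitrary: i rule: cheb.induct) (auto simp: coeff_pCons split: nat.splits)

lemma degree_diff_eq_left:
  fixes p q :: "'a::ab_group_add poly"
  assumes "degree q < degree p"
  shows "degree (p - q) = degree p"
  using degree_add_eq_left[of "- q" p] assms by simp

lemma degree_cheb: "degree (cheb (Suc k)) = Suc k \<and> coeff (cheb (Suc k)) (Suc k) = 1"
proof (induction k rule: less_induct)
  case (less k)
  show ?case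
  proof (cases k)
    case 0 then show ?thesis by simp
  next
    case (Suc m)
    have IH: "degree (cheb (Suc m)) = Suc m" "coeff (cheb (Suc m)) (Suc m) = 1"
      using less[OF lessI[of m, folded Suc]] by blast+
    have ne: "cheb (Suc m) \<noteq> 0" using IH by auto
    have d: "degree (cheb m) < degree (pCons 0 (cheb (Suc m)))"
      using less[of "m - 1"] Suc IH ne by (cases m) auto
    have "degree (cheb (Suc (Suc m))) = Suc (Suc m)"
      using d IH ne by (simp add: degree_diff_eq_left)
    moreover have "coeff (cheb (Suc (Suc m))) (Suc (Suc m)) = 1"
      using d IH ne by (simp add: coeff_eq_0)
    ultimately show ?thesis using Suc by simp
  qed
qed

text \<open>Niven's theorem: rational algebraic integers are integers.\<close>

lemma two_cos_rational_imp_integer: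
  assumes n: "n > 0" and r: "cos (2 * pi * k / real n) \<in> \<rat>" and k: "k \<in> \<int>"
  shows "2 * cos (2 * pi * k / real n) \<in> \<int>"
proof (rule rational_algebraic_int_is_int)
  obtain m where m: "n = Suc m" using n by (cases n) auto
  show "algebraic_int (2 * cos (2 * pi * k / real n))"
  proof (rule algebraic_int.intros)
    let ?p = "cheb n - [:2:]"
    have d: "degree ?p = n" using degree_cheb[of m] m by (simp add: degree_diff_eq_left)
    show "lead_coeff ?p = 1" unfolding d using degree_cheb[of m] m by simp
    show "\<forall>i. coeff ?p i \<in> \<int>" using coeff_cheb_Ints by (auto simp: coeff_pCons split: nat.splits)
    have "cos (2 * pi * k) = 1" using k by (auto elim!: Ints_cases)
    then show "poly ?p (2 * cos (2 * pi * k / real n)) = 0" using n by (simp add: poly_cheb)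
  qed
  show "2 * cos (2 * pi * k / real n) \<in> \<rat>" using r by simp
qed

text \<open>In the open first quadrant, \<open>1\<close> is the only integer value of \<open>2 cos\<close>.\<close>

lemma cos_rational_values:
  assumes n: "n > 0" and k: "k \<in> \<int>" and r: "cos (2 * pi * k / real n) \<in> \<rat>"
    and pos: "0 < 2 * pi * k / real n" "2 * pi * k / real n < pi / 2"
  shows "2 * pi * k / real n = pi / 3"
proof -
  define x where "x = 2 * pi * k / real n"
  have x: "0 < x" "x < pi / 2" using pos by (simp_all only: x_def)
  obtain m :: int where m: "2 * cos x = of_int m"
    using two_cos_rational_imp_integer[OF n r k] unfolding x_def by (elim Ints_cases)
  have "0 < cos x" using x by (intro cos_gt_zero_pi) auto
  moreover have "cos x < 1" using cos_monotone_0_pi[of 0 x] x by simp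
  ultimately have "0 < real_of_int m" "real_of_int m < 2" using m by linarith+
  then have "m = 1" by linarith
  then have "cos x = 1 / 2" using m by simp
  then have eq: "cos x = cos (pi / 3)" by (simp only: cos_60)
  have "x = pi / 3" by (rule cos_inj_pi[OF _ _ _ _ eq]) (use x in linarith)+
  then show ?thesis by (simp only: x_def)
qed

lemma cos_quadruple: "cos (4 * x) = 8 * cos x ^ 4 - 8 * cos x ^ 2 + (1::real)"
proof -
  have "cos (4 * x) = 2 * (2 * (cos x)\<^sup>2 - 1)\<^sup>2 - 1"
    using cos_double_cos[of "2 * x"] by (simp add: cos_double_cos)
  also have "\<dots> = 8 * cos x ^ 4 - 8 * cos x ^ 2 + 1"
    by (simp add: eval_nat_numeral algebra_simps)
  finally show ?thesis .
qed

lemma cos_quintuple: "cos (5 * x) = 16 * cos x ^ 5 - 20 * cos x ^ 3 + 5 * cos (x::real)"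
proof -
  have "cos (4 * x + x) + cos (4 * x - x) = 2 * cos (4 * x) * cos x"
    by (simp only: cos_add cos_diff)
  then have "cos (5 * x) = 2 * cos (4 * x) * cos x - cos (3 * x)"
    by simp
  also have "\<dots> = 16 * cos x ^ 5 - 20 * cos x ^ 3 + 5 * cos x"
    unfolding cos_quadruple cos_treble_cos by (simp add: eval_nat_numeral algebra_simps)
  finally show ?thesis .
qed

lemma rational_quotient_value:
  fixes a b r :: real
  assumes "a / b \<in> \<rat>" "a = r * b" "b \<noteq> 0"
  shows "r \<in> \<rat>"
  using assms by simp

lemma rational_if_product:
  fixes p q y :: real
  assumes "p * y = q" "p \<in> \<rat>" "q \<in> \<rat>" "p \<noteq> 0"
  shows "y \<in> \<rat>"
proof -
  have "y = q / p" using assms by (simp add: field_simps)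
  then show ?thesis using assms by simp
qed

section \<open>A cycle with one additional edge\<close>

lemma cycle_weight_eq:
  assumes "n \<ge> 3" "i < n" "j < n"
  shows "cycle_weight n i j =
    (if i = (if Suc j = n then 0 else Suc j) then 1 else 0) +
    (if i = (if j = 0 then n - 1 else j - 1) then 1 else 0)"
proof -
  have up: "[int i - int j = 1] (mod int n) \<longleftrightarrow> i = (if Suc j = n then 0 else Suc j)"
  proof -
    have "[int i - int j = 1] (mod int n) \<longleftrightarrow> [int i = int j + 1] (mod int n)"
      using cong_add_rcancel[of "int i - int j" "int j" 1 "int n"] by (simp add: add.commute)
    also have "\<dots> \<longleftrightarrow> [i = Suc j] (mod n)"
      using cong_int_iff[of i "Suc j" n] by (simp add: add.commute)
    also have "\<dots> \<longleftrightarrow> i = Suc j mod n" using assms by (simp add: cong_def)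
    finally show ?thesis using assms by (auto simp: mod_Suc)
  qed
  have down: "[int i - int j = -1] (mod int n) \<longleftrightarrow> i = (if j = 0 then n - 1 else j - 1)"
  proof -
    have "[int i - int j = -1] (mod int n) \<longleftrightarrow> [int i + 1 = int j] (mod int n)"
      using cong_add_rcancel[of "int i - int j" "int j + 1" "-1" "int n"] by (simp add: add.commute)
    also have "\<dots> \<longleftrightarrow> [Suc i = j] (mod n)"
      using cong_int_iff[of "Suc i" j n] by (simp add: add.commute)
    also have "\<dots> \<longleftrightarrow> Suc i mod n = j" using assms by (simp add: cong_def)
    finally show ?thesis using assms by (auto simp: mod_Suc)
  qed
  show ?thesis unfolding cycle_weight_def up down using assms by auto
qed

lemma cycle_weight_commute: "cycle_weight n i j = cycle_weight n j i"
proof -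
  have "[int i - int j = a] (mod int n) \<longleftrightarrow> [int j - int i = - a] (mod int n)" for a
    using cong_minus_minus_iff[of "int i - int j" a "int n"] by simp
  from this[of 1] this[of "-1"] show ?thesis by (auto simp: cycle_weight_def)
qed

locale cycle_plus_edge =
  fixes n b :: nat and \<rho> :: real
  assumes n: "n \<ge> 3" and b: "0 < b" "b < n"
begin

abbreviation "w \<equiv> add_edge (cycle_weight n) \<rho> 0 b"
abbreviation "L \<equiv> laplacian_mat n w"
abbreviation "Q \<equiv> signless_laplacian_mat n w"

lemma matrices_carrier: "L \<in> carrier_mat n n" "Q \<in> carrier_mat n n"
  by (auto simp: laplacian_mat_def signless_laplacian_mat_def row_sum_mat_def adjacency_mat_def)

text \<open>The convention \<open>z n = z 0\<close> closes the cycle, so that the successor needs no case distinction.\<close>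

lemma weighted_neighbour_sum:
  assumes z: "z n = z 0" and j: "j < n"
  shows "(\<Sum>i<n. z i * w i j) =
    z (Suc j) + z (if j = 0 then n - 1 else j - 1)
    + (if j = 0 then \<rho> * z b else 0) + (if j = b then \<rho> * z 0 else 0)"
proof -
  define s where "s = (if Suc j = n then 0 else Suc j)"
  define p where "p = (if j = 0 then n - 1 else j - 1)"
  have "z i * w i j = (if i = s then z i else 0) + (if i = p then z i else 0)
      + (if i = b then (if j = 0 then \<rho> * z i else 0) else 0)
      + (if i = 0 then (if j = b then \<rho> * z i else 0) else 0)" if "i < n" for i
  proof -
    have "(if {i, j} = {0, b} then \<rho> else 0) =
        (if i = b then (if j = 0 then \<rho> else 0) else 0) +
        (if i = 0 then (if j = b then \<rho> else 0) else 0)"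
      using b by (auto simp: doubleton_eq_iff)
    then show ?thesis
      unfolding add_edge_def cycle_weight_eq[OF n that j] s_def[symmetric] p_def[symmetric]
      by (simp only: distrib_left if_distrib[of "\<lambda>x. z i * x"] mult_zero_right mult_1_right mult.commute
          mult_zero_left mult_1_left add.assoc)
  qed
  then have "(\<Sum>i<n. z i * w i j) =
    (\<Sum>i<n. (if i = s then z i else 0) + (if i = p then z i else 0)
      + (if i = b then (if j = 0 then \<rho> * z i else 0) else 0)
      + (if i = 0 then (if j = b then \<rho> * z i else 0) else 0))"
    by (intro sum.cong refl) simp
  also have "\<dots> = z s + z p + (if j = 0 then \<rho> * z b else 0) + (if j = b then \<rho> * z 0 else 0)"
  proof -
    have "s < n" "p < n" using n j by (auto simp: s_def p_def)
    then show ?thesis using n b by (simp only: sum.distrib sum.delta) simp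
  qed
  also have "z s = z (Suc j)" using z by (auto simp: s_def)
  also have "p = (if j = 0 then n - 1 else j - 1)" by (rule p_def)
  finally show ?thesis .
qed

lemma degree_eq:
  assumes "j < n"
  shows "(\<Sum>k<n. w j k) = 2 + (if j = 0 then \<rho> else 0) + (if j = b then \<rho> else 0)"
proof -
  have "w j k = 1 * w k j" for k
    unfolding add_edge_def cycle_weight_commute[of n j k] insert_commute[of j k] by simp
  then have "(\<Sum>k<n. w j k) = (\<Sum>k<n. 1 * w k j)" by (rule sum.cong[OF refl])
  also have "\<dots> = 2 + (if j = 0 then \<rho> else 0) + (if j = b then \<rho> else 0)"
    unfolding weighted_neighbour_sum[of "\<lambda>_. 1", OF refl assms] by simp
  finally show ?thesis .
qed

lemma matrix_entry:
  assumes "i < n" "j < n"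
  shows "L $$ (i, j) = (if i = j then \<Sum>k<n. w j k else 0) - w i j"
    "Q $$ (i, j) = (if i = j then \<Sum>k<n. w j k else 0) + w i j"
  using assms
  by (auto simp: laplacian_mat_def signless_laplacian_mat_def row_sum_mat_def adjacency_mat_def)

lemma row_product:
  assumes z: "z n = z 0" and j: "j < n"
  shows "(\<Sum>i<n. z i * L $$ (i, j)) =
      2 * z j - z (Suc j) - z (if j = 0 then n - 1 else j - 1)
      + (if j = 0 then \<rho> * (z 0 - z b) else 0) + (if j = b then \<rho> * (z b - z 0) else 0)"
    and "(\<Sum>i<n. z i * Q $$ (i, j)) =
      2 * z j + z (Suc j) + z (if j = 0 then n - 1 else j - 1)
      + (if j = 0 \<or> j = b then \<rho> * (z 0 + z b) else 0)"
proof -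
  have diag: "(\<Sum>i<n. z i * (if i = j then d else 0)) = z j * d" for d
  proof -
    have "(\<Sum>i<n. z i * (if i = j then d else 0)) = (\<Sum>i<n. if i = j then z i * d else 0)"
      by (intro sum.cong) auto
    then show ?thesis using j by simp
  qed
  have "(\<Sum>i<n. z i * L $$ (i, j)) = z j * (\<Sum>k<n. w j k) - (\<Sum>i<n. z i * w i j)"
    using j by (simp add: matrix_entry right_diff_distrib sum_subtractf diag)
  then show "(\<Sum>i<n. z i * L $$ (i, j)) =
      2 * z j - z (Suc j) - z (if j = 0 then n - 1 else j - 1)
      + (if j = 0 then \<rho> * (z 0 - z b) else 0) + (if j = b then \<rho> * (z b - z 0) else 0)"
    using b weighted_neighbour_sum[OF z j] degree_eq[OF j] by (auto simp: algebra_simps)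
  have "(\<Sum>i<n. z i * Q $$ (i, j)) = z j * (\<Sum>k<n. w j k) + (\<Sum>i<n. z i * w i j)"
    using j by (simp add: matrix_entry distrib_left sum.distrib diag)
  then show "(\<Sum>i<n. z i * Q $$ (i, j)) =
      2 * z j + z (Suc j) + z (if j = 0 then n - 1 else j - 1)
      + (if j = 0 \<or> j = b then \<rho> * (z 0 + z b) else 0)"
    using b weighted_neighbour_sum[OF z j] degree_eq[OF j] by (auto simp: algebra_simps)
qed

section \<open>Explicit eigenvectors\<close>

text \<open>A wave of period \<open>n\<close> is an eigenvector of the cycle.  The Laplacian of the additional edge
  only sees the difference of its values at \<open>0\<close> and \<open>b\<close>, the signless Laplacian only the sum.\<close>

lemma laplacian_wave:
  fixes F :: "real \<Rightarrow> real"
  assumes per: "\<And>x. F (x + real n) = F x" and rec: "\<And>x. F (x + 1) + F (x - 1) = t * F x"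
    and ends: "F 0 = F (real b)"
  shows "row_eigenvector L (\<lambda>i. F (real i)) (2 - t)"
proof -
  have "(\<Sum>i<n. F (real i) * L $$ (i, j)) = (2 - t) * F j" if j: "j < n" for j
  proof -
    have pred: "F (real (if j = 0 then n - 1 else j - 1)) = F (real j - 1)"
      using per[of "-1"] n by (auto simp: of_nat_diff)
    have closed: "F (real n) = F (real 0)" using per[of 0] by simp
    have flat: "F (real 0) - F (real b) = 0" "F (real b) - F (real 0) = 0" using ends by simp_all
    have "(\<Sum>i<n. F (real i) * L $$ (i, j)) = 2 * F j - F (real j + 1) - F (real j - 1)"
      unfolding row_product(1)[of "\<lambda>i. F (real i)", OF closed j] pred flat by (simp add: add.commute)
    then show ?thesis using rec[of j] by (simp add: algebra_simps)
  qed
  then show ?thesis using matrices_carrier by (simp add: row_eigenvector_def)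
qed

lemma signless_wave:
  fixes F :: "real \<Rightarrow> real"
  assumes per: "\<And>x. F (x + real n) = F x" and rec: "\<And>x. F (x + 1) + F (x - 1) = t * F x"
    and ends: "F 0 + F (real b) = 0"
  shows "row_eigenvector Q (\<lambda>i. F (real i)) (2 + t)"
proof -
  have "(\<Sum>i<n. F (real i) * Q $$ (i, j)) = (2 + t) * F j" if j: "j < n" for j
  proof -
    have pred: "F (real (if j = 0 then n - 1 else j - 1)) = F (real j - 1)"
      using per[of "-1"] n by (auto simp: of_nat_diff)
    have closed: "F (real n) = F (real 0)" using per[of 0] by simp
    have flat: "F (real 0) + F (real b) = 0" using ends by simp
    have "(\<Sum>i<n. F (real i) * Q $$ (i, j)) = 2 * F j + F (real j + 1) + F (real j - 1)"
      unfolding row_product(2)[of "\<lambda>i. F (real i)", OF closed j] pred flat by (simp add: add.commute)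
    then show ?thesis using rec[of j] by (simp add: algebra_simps)
  qed
  then show ?thesis using matrices_carrier by (simp add: row_eigenvector_def)
qed

lemma laplacian_cos:
  "row_eigenvector L (\<lambda>i. cos (real k * (pi * (2 * real i - b) / n)))
     (2 - 2 * cos (real k * (2 * pi / n)))"
proof (rule laplacian_wave)
  let ?F = "\<lambda>x. cos (real k * (pi * (2 * x - real b) / real n))"
  fix x
  have "real k * (pi * (2 * (x + real n) - real b) / real n)
      = real k * (pi * (2 * x - real b) / real n) + 2 * of_nat k * pi"
    using n by (simp add: field_simps)
  then show "?F (x + real n) = ?F x" using cos_npi[of "2 * k"] sin_npi[of "2 * k"]
    by (simp add: cos_add mult_ac)
  have "real k * (pi * (2 * (x + 1) - real b) / real n)
      = real k * (pi * (2 * x - real b) / real n) + real k * (2 * pi / real n)"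
    "real k * (pi * (2 * (x - 1) - real b) / real n)
      = real k * (pi * (2 * x - real b) / real n) - real k * (2 * pi / real n)"
    using n by (simp_all add: field_simps)
  then show "?F (x + 1) + ?F (x - 1) = 2 * cos (real k * (2 * pi / n)) * ?F x"
    by (simp add: cos_add cos_diff)
next
  show "cos (real k * (pi * (2 * 0 - real b) / real n)) = cos (real k * (pi * (2 * real b - real b) / real n))"
    by simp
qed

text \<open>The phase \<open>d\<close> is free because two choices matter: \<open>d = b\<close> is always possible, and \<open>d = 0\<close> when
  \<open>0\<close> and \<open>b\<close> are opposite.\<close>

lemma signless_sin:
  assumes F: "F = (\<lambda>x. sin (real k * (pi * (2 * x - d) / n)))" and ends: "F 0 + F (real b) = 0"
  shows "row_eigenvector Q (\<lambda>i. sin (real k * (pi * (2 * real i - d) / n)))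
     (2 + 2 * cos (real k * (2 * pi / n)))"
proof -
  have "row_eigenvector Q (\<lambda>i. F (real i)) (2 + 2 * cos (real k * (2 * pi / n)))"
  proof (rule signless_wave)
    fix x
    have "real k * (pi * (2 * (x + real n) - d) / real n)
        = real k * (pi * (2 * x - d) / real n) + 2 * of_nat k * pi"
      using n by (simp add: field_simps)
    then show "F (x + real n) = F x" using cos_npi[of "2 * k"] sin_npi[of "2 * k"]
      by (simp add: F sin_add mult_ac)
    have "real k * (pi * (2 * (x + 1) - d) / real n)
        = real k * (pi * (2 * x - d) / real n) + real k * (2 * pi / real n)"
      "real k * (pi * (2 * (x - 1) - d) / real n)
        = real k * (pi * (2 * x - d) / real n) - real k * (2 * pi / real n)"
      using n by (simp_all add: field_simps)
    then show "F (x + 1) + F (x - 1) = 2 * cos (real k * (2 * pi / n)) * F x"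
      by (simp add: F sin_add sin_diff)
  qed (rule ends)
  then show ?thesis by (simp add: F)
qed

lemma signless_sin_antisymmetric:
  "row_eigenvector Q (\<lambda>i. sin (real k * (pi * (2 * real i - b) / n)))
     (2 + 2 * cos (real k * (2 * pi / n)))"
  by (rule signless_sin[OF refl]) simp

lemma signless_sin_opposite:
  assumes "n = 2 * b"
  shows "row_eigenvector Q (\<lambda>i. sin (real k * (2 * pi * real i / n)))
     (2 + 2 * cos (real k * (2 * pi / n)))"
proof -
  have "sin (real k * (pi * (2 * real b - 0) / real n)) = 0"
    using assms b by simp
  from signless_sin[OF refl, of k 0] this show ?thesis by (simp add: mult_ac)
qed

text \<open>On each of the two arcs between \<open>0\<close> and \<open>b\<close>, of half-lengths \<open>\<alpha>\<close> and \<open>\<beta>\<close>, the eigenvector is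
  a multiple of \<open>C\<close> centred at the midpoint of the arc.  The factors \<open>C \<beta>\<close> and \<open>C \<alpha>\<close> make the two
  pieces agree at \<open>0\<close> and \<open>b\<close>, and \<open>glue\<close> is the eigenvalue equation at these two vertices.\<close>

lemma signless_two_arcs:
  fixes C :: "real \<Rightarrow> real"
  assumes rec: "\<And>x. C (x + 1) + C (x - 1) = t * C x" and even: "\<And>x. C (- x) = C x"
    and \<alpha>: "\<alpha> = real b / 2" and \<beta>: "\<beta> = (real n - real b) / 2"
    and glue: "C \<beta> * C (\<alpha> - 1) + C \<alpha> * C (\<beta> - 1) + 2 * \<rho> * C \<alpha> * C \<beta> = t * C \<alpha> * C \<beta>"
  shows "row_eigenvector Q
    (\<lambda>i. if i \<le> b then C \<beta> * C (real i - \<alpha>) else C \<alpha> * C (real i - (real b + real n) / 2))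
    (2 + t)"
proof -
  define z where "z = (\<lambda>i. if i \<le> b then C \<beta> * C (real i - \<alpha>)
     else C \<alpha> * C (real i - (real b + real n) / 2))"
  have z0: "z 0 = C \<alpha> * C \<beta>" using even[of \<alpha>] by (simp add: z_def)
  have zb: "z b = C \<alpha> * C \<beta>" by (simp add: z_def \<alpha> field_simps)
  have right: "z i = C \<alpha> * C (real i - (real b + real n) / 2)" if "b \<le> i" for i
  proof (cases "i = b")
    case True
    then have "real i - (real b + real n) / 2 = - \<beta>" by (simp add: \<beta> field_simps)
    then show ?thesis using zb even[of \<beta>] True by simp
  qed (use that in \<open>simp add: z_def\<close>)
  have left: "z i = C \<beta> * C (real i - \<alpha>)" if "i \<le> b" for i using that by (simp add: z_def)
  have zn: "z n = z 0"
  proof -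
    have "real n - (real b + real n) / 2 = \<beta>" by (simp add: \<beta> field_simps)
    then show ?thesis using right[of n] b z0 by simp
  qed
  have "(\<Sum>i<n. z i * Q $$ (i, j)) = (2 + t) * z j" if j: "j < n" for j
  proof -
    consider "j = 0" | "0 < j" "j < b" | "j = b" | "b < j" by linarith
    then have "z (Suc j) + z (if j = 0 then n - 1 else j - 1)
        + (if j = 0 \<or> j = b then \<rho> * (z 0 + z b) else 0) = t * z j"
    proof cases
      case 1
      have "z (Suc 0) = C \<beta> * C (\<alpha> - 1)"
        using left[of 1] even[of "\<alpha> - 1"] b by simp
      moreover have "z (n - 1) = C \<alpha> * C (\<beta> - 1)"
      proof -
        have "real (n - 1) - (real b + real n) / 2 = \<beta> - 1"
          using n by (simp add: \<beta> of_nat_diff field_simps)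
        moreover have "b \<le> n - 1" using b by simp
        ultimately show ?thesis using right[of "n - 1"] by (simp only:)
      qed
      ultimately show ?thesis using 1 z0 zb glue by (simp add: algebra_simps)
    next
      case 2
      have "Suc j \<le> b" "j - 1 \<le> b" using 2 by auto
      moreover have "real (Suc j) - \<alpha> = (real j - \<alpha>) + 1" "real (j - 1) - \<alpha> = (real j - \<alpha>) - 1"
        using 2 by (auto simp: of_nat_diff)
      ultimately have "z (Suc j) + z (j - 1) = C \<beta> * (C (real j - \<alpha> + 1) + C (real j - \<alpha> - 1))"
        using left[of "Suc j"] left[of "j - 1"] 2 by (simp only: distrib_left)
      then show ?thesis using rec[of "real j - \<alpha>"] left[of j] 2 by simp
    next
      case 3
      have "real (b - 1) - \<alpha> = \<alpha> - 1" using b by (simp add: \<alpha> of_nat_diff)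
      then have "z (b - 1) = C \<beta> * C (\<alpha> - 1)" using left[of "b - 1"] by simp
      moreover have "z (Suc b) = C \<alpha> * C (\<beta> - 1)"
      proof -
        have "real (Suc b) - (real b + real n) / 2 = - (\<beta> - 1)" by (simp add: \<beta> field_simps)
        then have "C (real (Suc b) - (real b + real n) / 2) = C (\<beta> - 1)" by (simp only: even)
        then show ?thesis using right[of "Suc b"] by simp
      qed
      ultimately show ?thesis using 3 z0 zb glue b by (simp add: algebra_simps)
    next
      case 4
      define y where "y = real j - (real b + real n) / 2"
      have "b \<le> Suc j" "b \<le> j - 1" using 4 by auto
      moreover have "real (Suc j) - (real b + real n) / 2 = y + 1"
        "real (j - 1) - (real b + real n) / 2 = y - 1"
        using 4 by (auto simp: of_nat_diff y_def)
      ultimately have "z (Suc j) + z (j - 1) = C \<alpha> * (C (y + 1) + C (y - 1))"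
        using right[of "Suc j"] right[of "j - 1"] 4 by (simp only: distrib_left)
      then show ?thesis using rec[of y] right[of j] 4 by (simp add: y_def)
    qed
    then show ?thesis
      using row_product(2)[OF zn j] by (simp add: algebra_simps)
  qed
  then show ?thesis using matrices_carrier by (simp add: row_eigenvector_def z_def)
qed

end

section \<open>No transfer for the Laplacian\<close>

context cycle_plus_edge
begin

text \<open>Write \<open>c = cos x\<close> with \<open>x = 2 \<pi> / n\<close>.  The eigenvalues \<open>2 - 2 cos (k x)\<close> and \<open>2 - 2 cos (2 k x)\<close> have
  ratio \<open>2 + 2 cos (k x)\<close>, so \<open>cos (k x)\<close> is rational as soon as both are in the support of \<open>u\<close>.  This
  works with \<open>k = 1\<close>, or with \<open>k = 2\<close> when \<open>cos \<phi> = 0\<close>.  If \<open>cos (2 \<phi>) = 0\<close>, the waves \<open>1\<close>, \<open>3\<close> and \<open>4\<close>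
  survive; their ratios \<open>(2 c + 1)\<^sup>2\<close> and \<open>8 c\<^sup>2 (c + 1)\<close> again force \<open>c\<close> to be rational.\<close>

lemma laplacian_no_state_transfer:
  assumes n13: "n \<ge> 13"
  shows "\<not> state_transfer L n u v \<tau> \<gamma>"
proof
  assume "state_transfer L n u v \<tau> \<gamma>"
  then interpret st: state_transfer L n u v \<tau> \<gamma> .
  define x where "x = 2 * pi / real n"
  define \<phi> where "\<phi> = pi * (2 * real u - real b) / real n"
  have x: "0 < x" "2 * x < pi / 3" using n13 by (auto simp: x_def field_simps)
  have supp: "2 - 2 * cos (real k * x) \<in> st.support" if "cos (real k * \<phi>) \<noteq> 0" for k
    unfolding st.support_def x_def using laplacian_cos[of k] that by (auto simp: \<phi>_def)
  have ratio: "(1 - cos (real k * x)) / (1 - cos (real l * x)) \<in> \<rat>"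
    if "cos (real k * \<phi>) \<noteq> 0" "cos (real l * \<phi>) \<noteq> 0" for k l
  proof -
    have "0 \<in> st.support" using supp[of 0] by simp
    then have "(2 - 2 * cos (real k * x) - 0) / (2 - 2 * cos (real l * x) - 0) \<in> \<rat>"
      using that supp by (intro st.support_ratio) auto
    moreover have "(2 - 2 * cos (real k * x) - 0) / (2 - 2 * cos (real l * x) - 0)
        = (1 - cos (real k * x)) / (1 - cos (real l * x))"
      using mult_divide_mult_cancel_left[of 2 "1 - cos (real k * x)" "1 - cos (real l * x)"]
      by (simp add: right_diff_distrib)
    ultimately show ?thesis by (simp only:)
  qed
  have irr: "cos (real k * x) \<notin> \<rat>" if "k \<in> {1, 2}" for k
  proof
    assume "cos (real k * x) \<in> \<rat>"
    moreover have "real k * x = 2 * pi * real k / real n" by (simp add: x_def)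
    ultimately have "real k * x = pi / 3"
      using cos_rational_values[of n "real k"] n x that by auto
    then show False using x that by auto
  qed
  have lt1: "cos (real k * x) < 1" if "k \<in> {1, 2}" for k
    using cos_monotone_0_pi[of 0 "real k * x"] x that by auto
  have double: "cos (real k * x) \<in> \<rat>"
    if "cos (real k * \<phi>) \<noteq> 0" "cos (real (2 * k) * \<phi>) \<noteq> 0" "k \<in> {1, 2}" for k
  proof -
    have "2 + 2 * cos (real k * x) \<in> \<rat>"
    proof (rule rational_quotient_value[OF ratio[OF that(2,1)]])
      have "cos (real (2 * k) * x) = 2 * (cos (real k * x))\<^sup>2 - 1"
        using cos_double_cos[of "real k * x"] by (simp add: mult.assoc)
      then show "1 - cos (real (2 * k) * x) = (2 + 2 * cos (real k * x)) * (1 - cos (real k * x))"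
        by (simp only:) (simp add: power2_eq_square algebra_simps)
      show "1 - cos (real k * x) \<noteq> 0" using lt1[OF that(3)] by simp
    qed
    then have "(2 + 2 * cos (real k * x) - 2) / 2 \<in> \<rat>" by (intro Rats_divide Rats_diff) auto
    then show ?thesis by simp
  qed
  have c2: "cos (2 * \<phi>) = 2 * (cos \<phi>)\<^sup>2 - 1" and c4: "cos (4 * \<phi>) = 2 * (cos (2 * \<phi>))\<^sup>2 - 1"
    using cos_double_cos[of \<phi>] cos_double_cos[of "2 * \<phi>"] by simp_all
  consider "cos \<phi> = 0" | "cos \<phi> \<noteq> 0" "cos (2 * \<phi>) \<noteq> 0" | "cos (2 * \<phi>) = 0" by blast
  then show False
  proof cases
    case 1
    then show False using double[of 2] irr[of 2] c2 c4 by simp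
  next
    case 2
    then show False using double[of 1] irr[of 1] by simp
  next
    case 3
    have "cos (3 * \<phi>) = cos \<phi> * (4 * (cos \<phi>)\<^sup>2 - 3)"
      unfolding cos_treble_cos by (simp add: eval_nat_numeral algebra_simps)
    moreover have "4 * (cos \<phi>)\<^sup>2 - 3 = - 1" using 3 c2 by simp
    moreover have "cos \<phi> \<noteq> 0" using 3 c2 by auto
    ultimately have nz: "cos (real 1 * \<phi>) \<noteq> 0" "cos (real 3 * \<phi>) \<noteq> 0" "cos (real 4 * \<phi>) \<noteq> 0"
      using c4 3 by simp_all
    define c where "c = cos x"
    have "0 < c" using x by (auto simp: c_def intro!: cos_gt_zero_pi)
    have "c < 1" using lt1[of 1] by (simp add: c_def)
    have "(2 * c + 1)\<^sup>2 \<in> \<rat>"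
    proof (rule rational_quotient_value[OF ratio[OF nz(2,1)]])
      show "1 - cos (real 3 * x) = (2 * c + 1)\<^sup>2 * (1 - cos (real 1 * x))"
        unfolding of_nat_numeral of_nat_1 mult_1 cos_treble_cos c_def
        by (simp add: eval_nat_numeral algebra_simps)
    qed (use \<open>c < 1\<close> in \<open>simp add: c_def\<close>)
    from Rats_divide[OF Rats_diff[OF this Rats_1], of 4]
    have "((2 * c + 1)\<^sup>2 - 1) / 4 \<in> \<rat>" by simp
    moreover have "c * c + c = ((2 * c + 1)\<^sup>2 - 1) / 4"
      by (simp add: power2_eq_square algebra_simps)
    ultimately have r: "c * c + c \<in> \<rat>" by (simp only:)
    have "8 * c\<^sup>2 * (c + 1) \<in> \<rat>"
    proof (rule rational_quotient_value[OF ratio[OF nz(3,1)]])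
      show "1 - cos (real 4 * x) = (8 * c\<^sup>2 * (c + 1)) * (1 - cos (real 1 * x))"
        unfolding of_nat_numeral of_nat_1 mult_1 cos_quadruple c_def
        by (simp add: eval_nat_numeral algebra_simps)
    qed (use \<open>c < 1\<close> in \<open>simp add: c_def\<close>)
    moreover have "(8 * (c * c + c)) * c = 8 * c\<^sup>2 * (c + 1)"
      by (simp add: power2_eq_square algebra_simps)
    moreover have "8 * (c * c + c) \<in> \<rat>" by (rule Rats_mult[OF _ r]) simp
    moreover have "8 * (c * c + c) \<noteq> 0" using \<open>0 < c\<close> by (simp add: add_pos_pos less_imp_neq[symmetric])
    ultimately have "c \<in> \<rat>" using rational_if_product by blast
    then show False using irr[of 1] by (simp add: c_def)
  qed
qed

end

section \<open>Secular equations\<close>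

text \<open>The secular equation of the Perron vector.  At \<open>s = 0\<close> the right-hand side is larger; the
  left-hand side wins for large \<open>s\<close> since \<open>cosh (\<alpha> s) cosh (\<beta> s) \<le> cosh ((\<alpha> + \<beta>) s)\<close>.\<close>

lemma exists_hyperbolic_root:
  fixes \<alpha> \<beta> \<rho> :: real
  assumes \<alpha>: "\<alpha> > 0" and \<beta>: "\<beta> > 0" and ge: "\<alpha> + \<beta> \<ge> 1" and \<rho>: "\<rho> > 0"
  obtains s where "s > 0"
    "sinh s * sinh ((\<alpha> + \<beta>) * s) = 2 * \<rho> * cosh (\<alpha> * s) * cosh (\<beta> * s)"
proof -
  define f where "f = (\<lambda>s. sinh s * sinh ((\<alpha> + \<beta>) * s) - 2 * \<rho> * cosh (\<alpha> * s) * cosh (\<beta> * s))"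
  \<comment> \<open>The summand \<open>1\<close> gives \<open>sinh X \<ge> 1\<close>, hence \<open>cosh X \<le> 2 sinh X\<close>; this loses a factor \<open>2\<close>, whence \<open>4 \<rho>\<close>.\<close>
  define S where "S = arsinh (4 * \<rho> + 1)"
  have S: "sinh S = 4 * \<rho> + 1" by (simp add: S_def sinh_arsinh_real)
  then have "S > 0" using \<rho> sinh_real_pos_iff[of S] by linarith
  let ?X = "(\<alpha> + \<beta>) * S"
  have X: "S \<le> ?X" using ge \<open>S > 0\<close> by simp
  then have sX: "sinh ?X \<ge> 4 * \<rho> + 1" using S sinh_real_le_iff[of S ?X] by linarith
  have "cosh ?X - sinh ?X = exp (- ?X)" by (rule cosh_minus_sinh)
  also have "\<dots> \<le> 1" using X \<open>S > 0\<close> by simp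
  finally have cX: "cosh ?X \<le> 2 * sinh ?X" using sX \<rho> by linarith
  have "cosh (\<alpha> * S) * cosh (\<beta> * S) \<le> cosh ?X"
    using \<alpha> \<beta> \<open>S > 0\<close> by (simp add: distrib_right cosh_add)
  then have "2 * \<rho> * (cosh (\<alpha> * S) * cosh (\<beta> * S)) \<le> 2 * \<rho> * (2 * sinh ?X)"
    using cX \<rho> by (intro mult_left_mono) auto
  also have "\<dots> = (4 * \<rho>) * sinh ?X" by simp
  also have "\<dots> \<le> sinh S * sinh ?X" using S sX \<rho> by (intro mult_right_mono) linarith+
  finally have "f S \<ge> 0" by (simp add: f_def mult.assoc)
  moreover have "f 0 \<le> 0" using \<rho> by (simp add: f_def)
  moreover have "continuous_on {0..S} f" unfolding f_def by (intro continuous_intros)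
  ultimately obtain s where s: "0 \<le> s" "s \<le> S" "f s = 0"
    using IVT'[of f 0 0 S] \<open>S > 0\<close> by auto
  have "s \<noteq> 0" using s(3) \<rho> by (auto simp: f_def)
  then show thesis using that[of s] s by (simp add: f_def)
qed

text \<open>The secular equation with trigonometric instead of hyperbolic functions.  Between
  \<open>\<pi> / (2 \<beta>)\<close>, where \<open>cos (\<beta> s)\<close> vanishes, and \<open>\<pi> / (\<alpha> + \<beta>)\<close>, where \<open>cos (\<beta> s) = - cos (\<alpha> s)\<close>, the
  left-hand side changes sign, and strictly inside this range \<open>\<alpha> s < \<pi> - \<beta> s \<le> \<pi> / 2\<close>, which gives the
  comparison of the cosines.\<close>

lemma exists_trigonometric_root:
  fixes \<alpha> \<beta> \<rho> :: real
  assumes \<alpha>: "\<alpha> > 0" and \<alpha>\<beta>: "\<alpha> < \<beta>" and ge: "\<alpha> + \<beta> \<ge> 1" and \<rho>: "\<rho> > 0"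
  obtains s where
    "sin s * sin ((\<alpha> + \<beta>) * s) + 2 * \<rho> * cos (\<alpha> * s) * cos (\<beta> * s) = 0"
    "\<bar>cos (\<beta> * s)\<bar> < \<bar>cos (\<alpha> * s)\<bar>"
proof -
  define f where "f = (\<lambda>s. sin s * sin ((\<alpha> + \<beta>) * s) + 2 * \<rho> * cos (\<alpha> * s) * cos (\<beta> * s))"
  define l where "l = pi / (2 * \<beta>)"
  define r where "r = pi / (\<alpha> + \<beta>)"
  have \<beta>: "\<beta> > 0" using \<alpha> \<alpha>\<beta> by simp
  have lr: "0 < l" "l < r" unfolding l_def r_def using \<alpha> \<alpha>\<beta> \<beta> by (auto intro!: divide_strict_left_mono)
  have r: "(\<alpha> + \<beta>) * r = pi" "r \<le> pi" using \<alpha> \<beta> ge by (auto simp: r_def divide_le_eq)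
  have l: "\<beta> * l = pi / 2" using \<beta> by (simp add: l_def)
  have bound: "(\<alpha> + \<beta>) * s \<le> pi" if "s \<le> r" for s
    using mult_left_mono[OF that, of "\<alpha> + \<beta>"] \<alpha> \<beta> r by simp
  have \<alpha>s: "0 < \<alpha> * s" "\<alpha> * s < pi / 2" if "0 < s" "s \<le> r" for s
  proof -
    show "0 < \<alpha> * s" using that \<alpha> by simp
    have "\<alpha> * s < \<beta> * s" using that \<alpha>\<beta> by simp
    then show "\<alpha> * s < pi / 2" using bound[OF that(2)] by (simp add: distrib_right)
  qed
  have "f l \<ge> 0"
  proof -
    have "sin l \<ge> 0" using lr r by (intro sin_ge_zero) auto
    moreover have "sin ((\<alpha> + \<beta>) * l) \<ge> 0" using lr \<alpha> \<beta> bound[of l] by (intro sin_ge_zero) auto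
    ultimately show ?thesis by (simp add: f_def l)
  qed
  moreover have fr: "f r < 0"
  proof -
    have "\<beta> * r = pi - \<alpha> * r" using r(1) by (simp add: algebra_simps)
    then have "cos (\<beta> * r) = - cos (\<alpha> * r)" by simp
    then have "f r = - (2 * \<rho> * (cos (\<alpha> * r))\<^sup>2)" by (simp add: f_def r power2_eq_square)
    moreover have "cos (\<alpha> * r) > 0" using \<alpha>s[of r] lr by (intro cos_gt_zero_pi) auto
    ultimately show ?thesis using \<rho> by simp
  qed
  moreover have "continuous_on {l..r} f" unfolding f_def by (intro continuous_intros)
  ultimately obtain s where s: "l \<le> s" "s \<le> r" "f s = 0"
    using IVT2'[of f r 0 l] lr by auto
  have "s < r" using s fr by (cases "s = r") auto
  then have lt: "(\<alpha> + \<beta>) * s < pi"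
    using mult_strict_left_mono[of s r "\<alpha> + \<beta>"] \<alpha> \<beta> r by simp
  have \<beta>s: "pi / 2 \<le> \<beta> * s" using mult_left_mono[OF s(1), of \<beta>] \<beta> l by simp
  have "cos (pi - \<beta> * s) < cos (\<alpha> * s)"
    using lt \<alpha>s[of s] s lr \<beta>s by (intro cos_monotone_0_pi) (auto simp: distrib_right)
  moreover have "cos (pi - \<beta> * s) \<ge> 0"
    using lt \<alpha>s[of s] s lr \<beta>s by (intro cos_ge_zero) (auto simp: distrib_right)
  ultimately have "\<bar>cos (\<beta> * s)\<bar> < \<bar>cos (\<alpha> * s)\<bar>" by simp
  then show thesis using that[of s] s(3) by (simp add: f_def)
qed

lemma sqrt3_irrational: "sqrt 3 \<notin> \<rat>"
proof
  assume r: "sqrt 3 \<in> \<rat>"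
  have "algebraic_int (sqrt 3)"
  proof (rule algebraic_int.intros)
    show "\<forall>i. coeff [:- 3, 0, 1::real:] i \<in> \<int>"
      by (auto simp: coeff_pCons split: nat.splits)
  qed (auto simp: power2_eq_square[symmetric])
  then obtain m :: int where m: "sqrt 3 = of_int m"
    using rational_algebraic_int_is_int[OF _ r] by (auto elim: Ints_cases)
  have "1 < sqrt 3" "sqrt 3 < 2" by (auto simp: real_less_rsqrt real_less_lsqrt)
  then have "1 < m" "m < 2" unfolding m by simp_all
  then show False by linarith
qed

text \<open>Up to scaling, \<open>cosh (k s)\<close> is a polynomial in \<open>2 cosh s\<close> with the parity of \<open>k\<close>.\<close>

lemma cosh_multiple_parity:
  fixes s :: real
  assumes "2 * cosh s / sqrt 3 \<in> \<rat>"
  shows "(if even k then cosh (real k * s) \<in> \<rat> else cosh (real k * s) / sqrt 3 \<in> \<rat>)"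
proof (induction k rule: cheb.induct)
  case 2
  have "(2 * cosh s / sqrt 3) / 2 \<in> \<rat>" by (rule Rats_divide[OF assms]) simp
  then show ?case by simp
next
  case (3 k)
  define q where "q = 2 * cosh s / sqrt 3"
  have q: "q \<in> \<rat>" "2 * cosh s = q * sqrt 3" using assms by (auto simp: q_def)
  have "cosh (real (Suc k) * s + s) + cosh (real (Suc k) * s - s) = 2 * cosh s * cosh (real (Suc k) * s)"
    unfolding cosh_add cosh_diff by simp
  then have rec: "cosh (real (Suc (Suc k)) * s) = q * (sqrt 3 * cosh (real (Suc k) * s)) - cosh (real k * s)"
    using q(2) by (simp add: algebra_simps)
  show ?case
  proof (cases "even k")
    case True
    have "sqrt 3 * cosh (real (Suc k) * s) = 3 * (cosh (real (Suc k) * s) / sqrt 3)"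
      by (simp add: field_simps)
    moreover have "3 * (cosh (real (Suc k) * s) / sqrt 3) \<in> \<rat>"
      by (rule Rats_mult) (use 3(1) True in simp_all)
    ultimately have "sqrt 3 * cosh (real (Suc k) * s) \<in> \<rat>" by (simp only:)
    then show ?thesis unfolding rec using 3(2) True q by simp
  next
    case False
    have "(q * (sqrt 3 * cosh (real (Suc k) * s)) - cosh (real k * s)) / sqrt 3
        = q * cosh (real (Suc k) * s) - cosh (real k * s) / sqrt 3"
      by (simp add: diff_divide_distrib)
    then show ?thesis unfolding rec using 3 False q by simp
  qed
qed simp

text \<open>The left-hand side is \<open>(cosh (7 s) - cosh (5 s)) / 2\<close>, a rational multiple of \<open>\<surd>3\<close>.  On the right, \<open>a\<close> and
  \<open>6 - a\<close> have the same parity, so the product is a positive rational number.\<close>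

lemma no_hyperbolic_root_sqrt3:
  fixes s :: real
  assumes q: "2 * cosh s / sqrt 3 \<in> \<rat>" and a: "a \<le> 6" and \<rho>: "\<rho> \<in> \<rat>" "\<rho> > 0"
  shows "sinh s * sinh (6 * s) \<noteq> 2 * \<rho> * cosh (real a * s) * cosh (real (6 - a) * s)"
proof
  assume eq: "sinh s * sinh (6 * s) = 2 * \<rho> * cosh (real a * s) * cosh (real (6 - a) * s)"
  let ?P = "cosh (real a * s) * cosh (real (6 - a) * s)"
  note par = cosh_multiple_parity[OF q]
  have "cosh (6 * s + s) - cosh (6 * s - s) = 2 * (sinh s * sinh (6 * s))"
    unfolding cosh_add cosh_diff by simp
  then have "sinh s * sinh (6 * s) / sqrt 3 = (cosh (7 * s) / sqrt 3 - cosh (5 * s) / sqrt 3) / 2"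
    by (simp add: field_simps)
  moreover have "cosh (7 * s) / sqrt 3 \<in> \<rat>" "cosh (5 * s) / sqrt 3 \<in> \<rat>"
    using par[of 7] par[of 5] by simp_all
  ultimately have l: "sinh s * sinh (6 * s) / sqrt 3 \<in> \<rat>" by (simp only:) simp
  have P: "?P \<in> \<rat>"
  proof (cases "even a")
    case True
    then show ?thesis using par[of a] par[of "6 - a"] a by simp
  next
    case False
    then have "(cosh (real a * s) / sqrt 3) * (cosh (real (6 - a) * s) / sqrt 3) \<in> \<rat>"
      using par[of a] par[of "6 - a"] a by (intro Rats_mult) auto
    from Rats_mult[OF _ this, of 3]
    have "3 * ((cosh (real a * s) / sqrt 3) * (cosh (real (6 - a) * s) / sqrt 3)) \<in> \<rat>" by simp
    then show ?thesis by simp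
  qed
  have "?P > 0" by simp
  have "2 * \<rho> \<in> \<rat>" using \<rho> by simp
  then have "(2 * \<rho> * ?P) / (sinh s * sinh (6 * s) / sqrt 3) \<in> \<rat>"
    using Rats_divide[OF Rats_mult[OF _ P] l] by blast
  moreover have "sinh s * sinh (6 * s) = 2 * \<rho> * ?P" using eq by (simp add: mult_ac)
  ultimately show False using \<open>?P > 0\<close> \<rho> sqrt3_irrational by simp
qed

context cycle_plus_edge
begin

text \<open>The values at the midpoints of the two arcs are recorded because perfect state transfer
  between these midpoints is the case in which the antisymmetric waves are of no use.\<close>

lemma signless_perron_vector:
  assumes \<rho>: "\<rho> > 0"
  defines "\<alpha> \<equiv> real b / 2" and "\<beta> \<equiv> (real n - real b) / 2"
  obtains s z where "s > 0"
    "sinh s * sinh ((\<alpha> + \<beta>) * s) = 2 * \<rho> * cosh (\<alpha> * s) * cosh (\<beta> * s)"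
    "row_eigenvector Q z (2 + 2 * cosh s)"
    "\<And>i. z i > 0"
    "\<And>i. 2 * i = b \<Longrightarrow> z i = cosh (\<beta> * s)"
    "\<And>i. 2 * i = b + n \<Longrightarrow> z i = cosh (\<alpha> * s)"
proof -
  have "\<alpha> > 0" "\<beta> > 0" "\<alpha> + \<beta> \<ge> 1" using b n by (auto simp: \<alpha>_def \<beta>_def field_simps)
  from exists_hyperbolic_root[OF this \<rho>] obtain s where s: "s > 0"
    "sinh s * sinh ((\<alpha> + \<beta>) * s) = 2 * \<rho> * cosh (\<alpha> * s) * cosh (\<beta> * s)" by blast
  define C where "C = (\<lambda>x. cosh (x * s))"
  let ?z = "\<lambda>i. if i \<le> b then C \<beta> * C (real i - \<alpha>) else C \<alpha> * C (real i - (real b + real n) / 2)"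
  have "row_eigenvector Q ?z (2 + 2 * cosh s)"
  proof (rule signless_two_arcs)
    show "C (x + 1) + C (x - 1) = 2 * cosh s * C x" for x
      by (simp add: C_def distrib_right left_diff_distrib cosh_add cosh_diff)
    show "C (- x) = C x" for x by (simp add: C_def)
    have "C \<beta> * C (\<alpha> - 1) + C \<alpha> * C (\<beta> - 1) + 2 * \<rho> * C \<alpha> * C \<beta>
        = 2 * cosh s * C \<alpha> * C \<beta> - sinh s * sinh ((\<alpha> + \<beta>) * s) + 2 * \<rho> * C \<alpha> * C \<beta>"
      by (simp add: C_def left_diff_distrib distrib_right cosh_diff sinh_add algebra_simps)
    then show "C \<beta> * C (\<alpha> - 1) + C \<alpha> * C (\<beta> - 1) + 2 * \<rho> * C \<alpha> * C \<beta> = 2 * cosh s * C \<alpha> * C \<beta>"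
      unfolding s(2) by (simp add: C_def)
  qed (simp_all add: \<alpha>_def \<beta>_def)
  moreover have "?z i > 0" for i by (simp add: C_def)
  moreover have "?z i = cosh (\<beta> * s)" if "2 * i = b" for i
  proof -
    have "real i - \<alpha> = 0" "i \<le> b" using that by (auto simp: \<alpha>_def)
    then show ?thesis by (simp add: C_def)
  qed
  moreover have "?z i = cosh (\<alpha> * s)" if "2 * i = b + n" for i
  proof -
    have mid: "real i - (real b + real n) / 2 = 0"
      using arg_cong[OF that, of real] by simp
    have "\<not> i \<le> b" using that b by simp
    then show ?thesis by (simp add: C_def mid)
  qed
  ultimately show thesis using that[OF s] by blast
qed

lemma signless_oscillating_vector:
  assumes \<rho>: "\<rho> > 0"
  defines "\<alpha> \<equiv> real b / 2" and "\<beta> \<equiv> (real n - real b) / 2"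
  assumes s: "sin s * sin ((\<alpha> + \<beta>) * s) + 2 * \<rho> * cos (\<alpha> * s) * cos (\<beta> * s) = 0"
  obtains z where
    "row_eigenvector Q z (2 + 2 * cos s)"
    "\<And>i. 2 * i = b \<Longrightarrow> z i = cos (\<beta> * s)"
    "\<And>i. 2 * i = b + n \<Longrightarrow> z i = cos (\<alpha> * s)"
proof -
  define C where "C = (\<lambda>x. cos (x * s))"
  let ?z = "\<lambda>i. if i \<le> b then C \<beta> * C (real i - \<alpha>) else C \<alpha> * C (real i - (real b + real n) / 2)"
  have "row_eigenvector Q ?z (2 + 2 * cos s)"
  proof (rule signless_two_arcs)
    show "C (x + 1) + C (x - 1) = 2 * cos s * C x" for x
      by (simp add: C_def distrib_right left_diff_distrib cos_add cos_diff)
    show "C (- x) = C x" for x by (simp add: C_def)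
    have "C \<beta> * C (\<alpha> - 1) + C \<alpha> * C (\<beta> - 1) + 2 * \<rho> * C \<alpha> * C \<beta>
        = 2 * cos s * C \<alpha> * C \<beta> + (sin s * sin ((\<alpha> + \<beta>) * s) + 2 * \<rho> * C \<alpha> * C \<beta>)"
      by (simp add: C_def left_diff_distrib distrib_right cos_diff sin_add algebra_simps)
    then show "C \<beta> * C (\<alpha> - 1) + C \<alpha> * C (\<beta> - 1) + 2 * \<rho> * C \<alpha> * C \<beta> = 2 * cos s * C \<alpha> * C \<beta>"
      using s by (simp add: C_def)
  qed (simp_all add: \<alpha>_def \<beta>_def)
  moreover have "?z i = cos (\<beta> * s)" if "2 * i = b" for i
  proof -
    have "real i - \<alpha> = 0" "i \<le> b" using that by (auto simp: \<alpha>_def)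
    then show ?thesis by (simp add: C_def)
  qed
  moreover have "?z i = cos (\<alpha> * s)" if "2 * i = b + n" for i
  proof -
    have mid: "real i - (real b + real n) / 2 = 0"
      using arg_cong[OF that, of real] by simp
    have "\<not> i \<le> b" using that b by simp
    then show ?thesis by (simp add: C_def mid)
  qed
  ultimately show thesis using that by blast
qed

end

section \<open>No transfer for the signless Laplacian\<close>

locale signless_transfer =
  cycle_plus_edge n b \<rho> +
  state_transfer "signless_laplacian_mat n (add_edge (cycle_weight n) \<rho> 0 b)" n u v \<tau> \<gamma>
  for n b :: nat and \<rho> :: real and u v :: nat and \<tau> :: real and \<gamma> :: complex +
  assumes n9: "n \<ge> 9" and \<rho>: "\<rho> > 0" "\<rho> \<in> \<rat>"
begin

definition x :: real where "x = 2 * pi / real n"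

definition cycle_support :: "nat \<Rightarrow> bool" where
  "cycle_support k \<longleftrightarrow> 2 + 2 * cos (real k * x) \<in> support"

lemma x_bounds: "0 < x" "x < pi / 4"
  using n9 by (auto simp: x_def field_simps)

lemma cos_x_bounds: "0 < cos x" "sqrt 2 / 2 < cos x" "cos x < 1"
  using x_bounds cos_monotone_0_pi[of x "pi / 4"] cos_monotone_0_pi[of 0 x]
  by (auto simp: cos_45 intro!: cos_gt_zero_pi)

lemma cos_x_irrational: "cos x \<notin> \<rat>"
proof
  assume "cos x \<in> \<rat>"
  then have "x = pi / 3"
    using cos_rational_values[of n 1] n x_bounds
    unfolding x_def[symmetric] mult_1_right by simp
  then show False using x_bounds by simp
qed

lemma cycle_ratio:
  assumes "cycle_support k" "cycle_support l" "cycle_support m"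
  shows "(cos (real k * x) - cos (real l * x)) / (cos (real m * x) - cos (real l * x)) \<in> \<rat>"
proof -
  have "(2 + 2 * cos (real k * x) - (2 + 2 * cos (real l * x)))
      / (2 + 2 * cos (real m * x) - (2 + 2 * cos (real l * x))) \<in> \<rat>"
    using assms unfolding cycle_support_def by (intro support_ratio)
  moreover have "2 + 2 * p - (2 + 2 * q) = 2 * (p - q)" for p q :: real
    by simp
  ultimately show ?thesis by (simp only: mult_divide_mult_cancel_left)
qed

text \<open>The factor \<open>y = 2 c + 1\<close> of \<open>cos (2 x) - c = (2 c + 1) (c - 1)\<close>, with \<open>c = cos x\<close>, is the coordinate in
  which the ratios become simplest.\<close>

lemma chebyshev_ratios:
  defines "y \<equiv> 2 * cos x + 1"
  assumes "cycle_support 1" "cycle_support 2"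
  shows "cycle_support 3 \<Longrightarrow> y - 1 / y \<in> \<rat>"
    and "cycle_support 4 \<Longrightarrow> y\<^sup>2 - y - 1 \<in> \<rat>"
    and "cycle_support 5 \<Longrightarrow> (y\<^sup>2 - 1) * (y - 2) \<in> \<rat>"
proof -
  define c where "c = cos x"
  have c: "0 < c" "c < 1" using cos_x_bounds by (simp_all add: c_def)
  have y: "y = 2 * c + 1" by (simp add: y_def c_def)
  have c2: "cos (2 * x) - c = y * (c - 1)"
    unfolding cos_double_cos c_def[symmetric] y by (simp add: eval_nat_numeral algebra_simps)
  then have nz: "cos (2 * x) - c \<noteq> 0" using c y by simp
  have r: "(cos (real k * x) - c) / (cos (2 * x) - c) \<in> \<rat>" if "cycle_support k" for k
    using cycle_ratio[OF that assms(2,3)] by (simp add: c_def)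
  have c3: "cos (3 * x) - c = (y - 1 / y) * (cos (2 * x) - c)"
  proof -
    have "(y - 1 / y) * y = y\<^sup>2 - 1" using c y by (simp add: power2_eq_square left_diff_distrib)
    then have "(y - 1 / y) * (cos (2 * x) - c) = (y\<^sup>2 - 1) * (c - 1)"
      unfolding c2 mult.assoc[symmetric] by (simp only:)
    then show ?thesis
      unfolding cos_treble_cos c_def[symmetric] by (simp add: y eval_nat_numeral algebra_simps)
  qed
  show "y - 1 / y \<in> \<rat>" if "cycle_support 3"
    using rational_quotient_value[OF r[OF that] _ nz] c3 by simp
  have c4: "cos (4 * x) - c = (y\<^sup>2 - y - 1) * (cos (2 * x) - c)"
    unfolding c2 cos_quadruple c_def[symmetric] by (simp add: y eval_nat_numeral algebra_simps)
  show "y\<^sup>2 - y - 1 \<in> \<rat>" if "cycle_support 4"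
    using rational_quotient_value[OF r[OF that] _ nz] c4 by simp
  have c5: "cos (5 * x) - c = ((y\<^sup>2 - 1) * (y - 2)) * (cos (2 * x) - c)"
    unfolding c2 cos_quintuple c_def[symmetric] by (simp add: y eval_nat_numeral algebra_simps)
  show "(y\<^sup>2 - 1) * (y - 2) \<in> \<rat>" if "cycle_support 5"
    using rational_quotient_value[OF r[OF that] _ nz] c5 by simp
qed

text \<open>Any two of the three rational quantities in \<open>chebyshev_ratios\<close> give a linear equation for \<open>y\<close>
  with rational coefficients.  Its leading coefficient vanishes only for values of \<open>y\<close> up to
  \<open>1 + \<surd>2\<close>, the value at \<open>n = 8\<close>, which \<open>n \<ge> 9\<close> rules out.\<close>

lemma small_support_False:
  assumes s12: "cycle_support 1" "cycle_support 2"
    and s: "cycle_support 3 \<and> cycle_support 4 \<or> cycle_support 3 \<and> cycle_support 5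
      \<or> cycle_support 4 \<and> cycle_support 5"
  shows False
proof -
  define y where "y = 2 * cos x + 1"
  note R = chebyshev_ratios[OF s12, folded y_def]
  have y: "1 + sqrt 2 < y" using cos_x_bounds by (simp add: y_def)
  have "1 < sqrt (2::real)" by simp
  then have y2: "2 < y" using y by linarith
  have "(sqrt 2)\<^sup>2 < (y - 1)\<^sup>2" using y by (intro power_strict_mono) auto
  then have ypos: "y\<^sup>2 - 2 * y - 1 > 0" by (simp add: power2_eq_square algebra_simps)
  have "y \<in> \<rat>"
    using s
  proof (elim disjE conjE)
    assume "cycle_support 3" "cycle_support 4"
    note r = R(1)[OF this(1)] R(2)[OF this(2)]
    have eq: "(y - 1 / y - 1) * y = y\<^sup>2 - y - 1"
      using y2 by (simp add: power2_eq_square left_diff_distrib)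
    show "y \<in> \<rat>"
    proof (rule rational_if_product[OF eq])
      show "y - 1 / y - 1 \<noteq> 0" using eq ypos y2 by auto
    qed (use r in auto)
  next
    assume "cycle_support 3" "cycle_support 5"
    note r = R(1)[OF this(1)] R(3)[OF this(2)]
    define q where "q = y - 1 / y"
    have q: "q * y = y\<^sup>2 - 1"
      using y2 by (simp add: q_def power2_eq_square left_diff_distrib)
    have "(q * (q - 2)) * y = q * (q * y) - 2 * (q * y)" by (simp add: algebra_simps)
    also have "\<dots> = (y\<^sup>2 - 1) * (y - 2) - q"
    proof -
      have "(y\<^sup>2 - 1) * y = q * y\<^sup>2" using q by (simp add: power2_eq_square)
      moreover have "q * (y\<^sup>2 - 1) = q * y\<^sup>2 - q" by (simp add: algebra_simps)
      ultimately show ?thesis unfolding q by (simp add: algebra_simps)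
    qed
    finally have eq: "(q * (q - 2)) * y = (y\<^sup>2 - 1) * (y - 2) - q" .
    have "(q - 2) * y = y\<^sup>2 - 2 * y - 1" using q by (simp add: algebra_simps)
    then have "q \<noteq> 2" using ypos by auto
    moreover have "q \<noteq> 0" using q ypos y2 by auto
    ultimately show "y \<in> \<rat>"
      using rational_if_product[OF eq] r by (simp add: q_def)
  next
    assume "cycle_support 4" "cycle_support 5"
    note r = R(2)[OF this(1)] R(3)[OF this(2)]
    define q where "q = y\<^sup>2 - y - 1"
    have eq: "(q - 1) * y = (y\<^sup>2 - 1) * (y - 2) + q - 1"
      by (simp add: q_def power2_eq_square algebra_simps)
    have "q - 1 = (y - 2) * (y + 1)" by (simp add: q_def power2_eq_square algebra_simps)
    then have "q - 1 \<noteq> 0" using y2 by simp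
    moreover have "q \<in> \<rat>" using r(1) by (simp only: q_def)
    ultimately show "y \<in> \<rat>"
      using rational_if_product[OF eq] r(2) by simp
  qed
  then have "(y - 1) / 2 \<in> \<rat>" by (intro Rats_divide Rats_diff) auto
  then show False using cos_x_irrational by (simp add: y_def)
qed

text \<open>The waves \<open>1\<close>, \<open>3\<close> and \<open>5\<close> make \<open>cos (2 x)\<close> rational, hence \<open>2 x = \<pi> / 3\<close>.  For \<open>n = 12\<close> the differences
  of their eigenvalues really are commensurable, and the Perron eigenvalue is needed.\<close>

lemma odd_support_False:
  assumes s: "cycle_support 1" "cycle_support 3" "cycle_support 5"
    and even: "n = 12 \<Longrightarrow> even b"
  shows False
proof -
  define c where "c = cos x"
  have c: "0 < c" "c < 1" using cos_x_bounds by (simp_all add: c_def)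
  have "4 * c\<^sup>2 - 1 \<in> \<rat>"
  proof (rule rational_quotient_value[OF cycle_ratio[OF s(3,1,2)]])
    show "cos (real 5 * x) - cos (real 1 * x) = (4 * c\<^sup>2 - 1) * (cos (real 3 * x) - cos (real 1 * x))"
      unfolding of_nat_numeral of_nat_1 mult_1 cos_quintuple cos_treble_cos c_def
      by (simp add: eval_nat_numeral algebra_simps)
    have "cos (3 * x) - cos x = 4 * c * (c\<^sup>2 - 1)"
      unfolding cos_treble_cos c_def by (simp add: eval_nat_numeral algebra_simps)
    moreover have "c\<^sup>2 < 1" using c by (simp add: power_less_one_iff)
    ultimately show "cos (real 3 * x) - cos (real 1 * x) \<noteq> 0" using c by simp
  qed
  from Rats_divide[OF Rats_diff[OF this Rats_1], of 2]
  have "(4 * c\<^sup>2 - 1 - 1) / 2 \<in> \<rat>" by simp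
  moreover have "cos (2 * x) = (4 * c\<^sup>2 - 1 - 1) / 2"
    unfolding cos_double_cos by (simp add: c_def field_simps)
  ultimately have "cos (2 * x) \<in> \<rat>" by (simp only:)
  then have "2 * pi * 2 / real n = pi / 3"
    using cos_rational_values[of n 2] n x_bounds by (simp add: x_def)
  then have n12: "n = 12" using n by (simp add: field_simps)
  then have x: "x = pi / 6" unfolding x_def by simp
  obtain a where a: "b = 2 * a" using even[OF n12] by (elim evenE)
  then have a6: "a \<le> 6" using b n12 by simp
  obtain t z where t: "t > 0"
    "sinh t * sinh ((real b / 2 + (real n - real b) / 2) * t)
        = 2 * \<rho> * cosh (real b / 2 * t) * cosh ((real n - real b) / 2 * t)"
    "row_eigenvector Q z (2 + 2 * cosh t)" "\<And>i. z i > 0"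
    using signless_perron_vector[OF \<rho>(1)] by metis
  have "2 + 2 * cosh t \<in> support"
    unfolding support_def using t(3) t(4)[of u] by (auto intro!: exI[of _ z])
  moreover have "cos (3 * x) = 0" "2 * cos x = sqrt 3" by (simp_all add: x cos_30)
  ultimately have "(2 + 2 * cosh t - (2 + 2 * cos (real 3 * x)))
      / (2 + 2 * cos (real 1 * x) - (2 + 2 * cos (real 3 * x))) \<in> \<rat>"
    using s unfolding cycle_support_def by (intro support_ratio)
  then have "2 * cosh t / sqrt 3 \<in> \<rat>"
    using \<open>cos (3 * x) = 0\<close> \<open>2 * cos x = sqrt 3\<close> by simp
  note no_root = no_hyperbolic_root_sqrt3[OF this a6 \<rho>(2,1)]
  have "sinh t * sinh (6 * t) = 2 * \<rho> * cosh (real a * t) * cosh (real (6 - a) * t)"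
  proof -
    have halves: "real b / 2 = real a" "(real n - real b) / 2 = real (6 - a)"
      using a6 by (simp_all add: a n12 of_nat_diff)
    have "real a + real (6 - a) = 6" using a6 by simp
    then show ?thesis using t(2) unfolding halves by simp
  qed
  with no_root show False by (rule notE)
qed

text \<open>The antisymmetric wave with index \<open>k\<close> has the value \<open>sin (k \<phi>)\<close> at \<open>u\<close>.\<close>

definition \<phi> :: real where "\<phi> = pi * (2 * real u - real b) / real n"

lemma cycle_support_if_sin:
  assumes "sin (real k * \<phi>) \<noteq> 0"
  shows "cycle_support k"
  using signless_sin_antisymmetric[of k] assms
  unfolding cycle_support_def support_def x_def \<phi>_def by auto

text \<open>If one of \<open>sin (2 \<phi>)\<close>, \<open>sin (3 \<phi>)\<close>, \<open>sin (4 \<phi>)\<close> vanishes, the addition theorem shows that the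
  wave \<open>5\<close> survives, along with enough of the others.\<close>

lemma sin_\<phi>_eq_0: "sin \<phi> = 0"
proof (rule ccontr)
  assume 1: "sin \<phi> \<noteq> 0"
  have s1: "cycle_support 1" using cycle_support_if_sin[of 1] 1 by simp
  have sq: "(sin y)\<^sup>2 + (cos y)\<^sup>2 = 1" for y :: real by simp
  show False
  proof (cases "cos \<phi> = 0")
    case True
    have c2: "cos (2 * \<phi>) = -1" "sin (2 * \<phi>) = 0"
      using True by (simp_all add: cos_double_cos sin_double)
    then have c4: "cos (4 * \<phi>) = 1" "sin (4 * \<phi>) = 0"
      using cos_double_cos[of "2 * \<phi>"] sin_double[of "2 * \<phi>"] by simp_all
    have "sin (3 * \<phi>) \<noteq> 0" "sin (5 * \<phi>) \<noteq> 0"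
      using sin_add[of "2 * \<phi>" \<phi>] sin_add[of "4 * \<phi>" \<phi>] c2 c4 1 by simp_all
    then have "cycle_support 3" "cycle_support 5"
      using cycle_support_if_sin[of 3] cycle_support_if_sin[of 5] by simp_all
    moreover have "even b" if "n = 12"
    proof -
      obtain i :: int where "\<phi> = of_int i * pi + pi / 2"
        using True by (auto simp: cos_zero_iff_int2)
      moreover have "\<phi> = pi * (2 * real u - real b) / real n" by (rule \<phi>_def)
      moreover have "real n = 12" using that by simp
      ultimately have "pi * (2 * real u - real b) / 12 = of_int i * pi + pi / 2" by (simp only:)
      then have "pi * (2 * real u - real b) = pi * (12 * of_int i + 6)"
        by (simp add: field_simps)
      then have "2 * real u - real b = 12 * of_int i + 6" by simp
      then have "2 * int u - int b = 12 * i + 6" by linarith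
      then have "even (int b)" by presburger
      then show ?thesis by simp
    qed
    ultimately show False using odd_support_False s1 by blast
  next
    case False
    then have "sin (2 * \<phi>) \<noteq> 0" using 1 by (simp add: sin_double)
    then have s2: "cycle_support 2" using cycle_support_if_sin[of 2] by simp
    consider "sin (3 * \<phi>) = 0" | "sin (3 * \<phi>) \<noteq> 0" "sin (4 * \<phi>) \<noteq> 0"
      | "sin (3 * \<phi>) \<noteq> 0" "sin (4 * \<phi>) = 0" by blast
    then show False
    proof cases
      case 1
      then have "cos (3 * \<phi>) \<noteq> 0" using sq[of "3 * \<phi>"] by auto
      then have "sin (4 * \<phi>) \<noteq> 0" "sin (5 * \<phi>) \<noteq> 0"
        using sin_add[of "3 * \<phi>" \<phi>] sin_add[of "3 * \<phi>" "2 * \<phi>"] 1 \<open>sin \<phi> \<noteq> 0\<close> \<open>sin (2 * \<phi>) \<noteq> 0\<close>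
        by simp_all
      then show False using small_support_False[OF s1 s2]
        cycle_support_if_sin[of 4] cycle_support_if_sin[of 5] by simp
    next
      case 2
      then show False using small_support_False[OF s1 s2]
        cycle_support_if_sin[of 3] cycle_support_if_sin[of 4] by simp
    next
      case 3
      then have "cos (4 * \<phi>) \<noteq> 0" using sq[of "4 * \<phi>"] by auto
      then have "sin (5 * \<phi>) \<noteq> 0"
        using sin_add[of "4 * \<phi>" \<phi>] 3 \<open>sin \<phi> \<noteq> 0\<close> by simp
      then show False using small_support_False[OF s1 s2] 3
        cycle_support_if_sin[of 3] cycle_support_if_sin[of 5] by simp
    qed
  qed
qed

lemma pole_if_sin_zero:
  assumes "sin (pi * (2 * real i - real b) / real n) = 0" "i < n"
  shows "2 * i = b \<or> 2 * i = b + n"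
proof -
  obtain k :: int where "pi * (2 * real i - real b) / real n = of_int k * pi"
    using assms(1) by (auto simp: sin_zero_iff_int2)
  then have "pi * (2 * real i - real b) = pi * (of_int k * real n)"
    using n by (simp add: field_simps)
  then have "2 * real i - real b = of_int k * real n" by simp
  then have "real_of_int (2 * int i - int b) = real_of_int (k * int n)" by simp
  then have eq: "2 * int i - int b = k * int n" by (simp only: of_int_eq_iff)
  have "- int n < k * int n" "k * int n < 2 * int n" using eq assms(2) b by linarith+
  then have "-1 < k" "k < 2"
    using n mult_less_cancel_right[of "-1" "int n" k] mult_less_cancel_right[of k "int n" 2] by auto
  then have "k = 0 \<or> k = 1" by linarith
  then show ?thesis using eq by auto
qed

text \<open>Both \<open>u\<close> and \<open>v\<close> are midpoints of arcs.  If the arcs differ in length, then at the midpoint of the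
  longer one the Perron vector is smaller and the eigenvector of \<open>exists_trigonometric_root\<close> is larger than at the other midpoint.
  Hence \<open>b\<close> is opposite to \<open>0\<close>, and all odd waves that vanish at both are in the support.\<close>

lemma transfer_impossible: False
proof -
  define \<alpha> where "\<alpha> = real b / 2"
  define \<beta> where "\<beta> = (real n - real b) / 2"
  have pos: "\<alpha> > 0" "\<beta> > 0" "\<alpha> + \<beta> \<ge> 1" using b n by (auto simp: \<alpha>_def \<beta>_def field_simps)
  obtain t p where t: "t > 0" and p: "row_eigenvector Q p (2 + 2 * cosh t)" "\<And>i. p i > 0"
    "\<And>i. 2 * i = b \<Longrightarrow> p i = cosh (\<beta> * t)" "\<And>i. 2 * i = b + n \<Longrightarrow> p i = cosh (\<alpha> * t)"
    using signless_perron_vector[OF \<rho>(1)] unfolding \<alpha>_def \<beta>_def by metis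
  \<comment> \<open>Since \<open>\<gamma> \<noteq> 0\<close>, which positivity of the Perron vector gives, a wave vanishing at \<open>u\<close> vanishes at \<open>v\<close>.\<close>
  have "\<gamma> \<noteq> 0" using modulus[OF p(1)] p(2)[of u] by auto
  then have "sin (pi * (2 * real v - real b) / real n) = 0"
    using modulus[OF signless_sin_antisymmetric[of 1]] sin_\<phi>_eq_0 by (simp add: \<phi>_def)
  then have v_pole: "2 * v = b \<or> 2 * v = b + n" by (rule pole_if_sin_zero[OF _ v])
  have u_pole: "2 * u = b \<or> 2 * u = b + n"
    using pole_if_sin_zero[OF _ u] sin_\<phi>_eq_0 by (simp add: \<phi>_def)
  \<comment> \<open>Exchanging \<open>u\<close> and \<open>v\<close> only exchanges the two sides, which covers both assignments of \<open>u\<close> and \<open>v\<close> to the midpoints.\<close>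
  have balance: "cosh (\<beta> * t) * \<bar>cos (\<alpha> * s)\<bar> = cosh (\<alpha> * t) * \<bar>cos (\<beta> * s)\<bar>"
    if root: "sin s * sin ((\<alpha> + \<beta>) * s) + 2 * \<rho> * cos (\<alpha> * s) * cos (\<beta> * s) = 0" for s
  proof -
    obtain z where z: "row_eigenvector Q z (2 + 2 * cos s)"
      "\<And>i. 2 * i = b \<Longrightarrow> z i = cos (\<beta> * s)" "\<And>i. 2 * i = b + n \<Longrightarrow> z i = cos (\<alpha> * s)"
      using signless_oscillating_vector[OF \<rho>(1) root[unfolded \<alpha>_def \<beta>_def], folded \<alpha>_def \<beta>_def]
      by blast
    have "\<bar>p u\<bar> * \<bar>z v\<bar> = \<bar>p v\<bar> * \<bar>z u\<bar>"
      unfolding modulus[OF p(1)] modulus[OF z(1)] by simp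
    then show ?thesis
      using u_pole v_pole uv p(3,4)[of u] p(3,4)[of v] z(2,3)[of u] z(2,3)[of v] by (auto simp: mult_ac)
  qed
  have "\<not> \<alpha> < \<beta>"
  proof
    assume lt: "\<alpha> < \<beta>"
    from exists_trigonometric_root[OF pos(1) lt pos(3) \<rho>(1)] obtain s where s:
      "sin s * sin ((\<alpha> + \<beta>) * s) + 2 * \<rho> * cos (\<alpha> * s) * cos (\<beta> * s) = 0"
      "\<bar>cos (\<beta> * s)\<bar> < \<bar>cos (\<alpha> * s)\<bar>" by blast
    have "cosh (\<alpha> * t) < cosh (\<beta> * t)"
      using lt pos t by (intro cosh_real_strict_mono) auto
    then have "cosh (\<alpha> * t) * \<bar>cos (\<beta> * s)\<bar> < cosh (\<beta> * t) * \<bar>cos (\<alpha> * s)\<bar>"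
      using s(2) by (intro mult_strict_mono) auto
    then show False using balance[OF s(1)] by simp
  qed
  moreover have "\<not> \<beta> < \<alpha>"
  proof
    assume lt: "\<beta> < \<alpha>"
    have "\<beta> + \<alpha> \<ge> 1" using pos by simp
    from exists_trigonometric_root[OF pos(2) lt this \<rho>(1)] obtain s where s:
      "sin s * sin ((\<beta> + \<alpha>) * s) + 2 * \<rho> * cos (\<beta> * s) * cos (\<alpha> * s) = 0"
      "\<bar>cos (\<alpha> * s)\<bar> < \<bar>cos (\<beta> * s)\<bar>" by blast
    have "cosh (\<beta> * t) < cosh (\<alpha> * t)"
      using lt pos t by (intro cosh_real_strict_mono) auto
    then have "cosh (\<beta> * t) * \<bar>cos (\<alpha> * s)\<bar> < cosh (\<alpha> * t) * \<bar>cos (\<beta> * s)\<bar>"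
      using s(2) by (intro mult_strict_mono) auto
    then show False using balance[of s] s(1) by (simp add: add.commute mult_ac)
  qed
  ultimately have "\<alpha> = \<beta>" by simp
  then have nb: "n = 2 * b" by (simp add: \<alpha>_def \<beta>_def)
  have "even b" using u_pole nb by presburger
  have \<psi>: "2 * pi * real u / real n = pi / 2 \<or> 2 * pi * real u / real n = pi / 2 + pi"
    using u_pole
  proof
    assume "2 * u = b"
    then show ?thesis using nb b by (simp add: field_simps)
  next
    assume "2 * u = b + n"
    then have "real u = 3 * real b / 2" using nb by simp
    then show ?thesis using nb b by (simp add: field_simps)
  qed
  have "cycle_support k" if k: "odd k" for k
  proof -
    obtain j where "k = 2 * j + 1" using k by (elim oddE)
    then have quarter: "real k * (pi / 2) = real j * pi + pi / 2" by (simp add: field_simps)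
    have "sin (real k * (pi / 2)) \<noteq> 0" unfolding quarter by (simp add: sin_add cos_npi)
    moreover have "\<bar>sin (real k * (pi / 2 + pi))\<bar> = \<bar>sin (real k * (pi / 2))\<bar>"
      unfolding distrib_left sin_add by (simp add: abs_mult)
    ultimately have "sin (real k * (2 * pi * real u / real n)) \<noteq> 0"
      using \<psi> by (metis abs_eq_0)
    then show ?thesis
      using signless_sin_opposite[OF nb, of k] unfolding cycle_support_def support_def x_def by auto
  qed
  then show False using odd_support_False \<open>even b\<close> by simp
qed

end

section \<open>Perfect state transfer\<close>

theorem theorem4:
  fixes n b \<rho> :: nat
  assumes "\<rho> > 0" and "b \<in> {0..<n} - {0}"
  shows "(n \<ge> 15 \<longrightarrow>
           \<not> perfect_vertex_state_transfer
               (laplacian_mat n (add_edge (cycle_weight n) (real \<rho>) 0 b))) \<and>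
         (n \<ge> 9 \<longrightarrow>
           \<not> perfect_vertex_state_transfer
               (signless_laplacian_mat n (add_edge (cycle_weight n) (real \<rho>) 0 b)))"
proof (intro conjI impI notI)
  assume n15: "n \<ge> 15" and pst: "perfect_vertex_state_transfer
    (laplacian_mat n (add_edge (cycle_weight n) (real \<rho>) 0 b))"
  interpret cycle_plus_edge n b "real \<rho>" using n15 assms by unfold_locales auto
  obtain u v \<tau> \<gamma> where "state_transfer L n u v \<tau> \<gamma>"
    using perfect_vertex_state_transferE[OF pst matrices_carrier(1)] .
  then show False using laplacian_no_state_transfer n15 by simp
next
  assume n9: "n \<ge> 9" and pst: "perfect_vertex_state_transfer
    (signless_laplacian_mat n (add_edge (cycle_weight n) (real \<rho>) 0 b))"
  interpret cycle_plus_edge n b "real \<rho>" using n9 assms by unfold_locales auto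
  obtain u v \<tau> \<gamma> where "state_transfer Q n u v \<tau> \<gamma>"
    using perfect_vertex_state_transferE[OF pst matrices_carrier(2)] .
  then interpret state_transfer Q n u v \<tau> \<gamma> .
  interpret signless_transfer n b "real \<rho>" u v \<tau> \<gamma>
    using n9 assms by unfold_locales auto
  show False by (rule transfer_impossible)
qed

end
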